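(* Every irreducible weight representation of $U$ is isomorphic to one of the following left $U$-modules, where $\alpha\in\mathbb{C}$, $\beta\in\mathbb{C}\setminus\{0\}$ and $P=M_{\alpha,\beta}=(\xi-\alpha,K-\beta)\subset R$: (a) $U/(UP+UE+UF^{n+1})$ with $\alpha=\frac{\beta^{m}-\beta^{-m}}{q-q^{-1}}$ and $\beta^{m}=\pm q^{mn}$ for some integer $n\geq 0$; (b) $U/(UP+UE)$ with $\alpha=\frac{\beta^{m}-\beta^{-m}}{q-q^{-1}}$ and $\beta^{m}\neq\pm q^{mn}$ for all integers $n\geq 0$; (c) $U/(UP+UF)$ with $\alpha=0$ and $\frac{1}{q-q^{-1}}\left(\frac{1-q^{2nm}}{1-q^{2m}}\beta^{m}-\frac{1-q^{-2nm}}{1-q^{-2m}}\beta^{-m}\right)\neq 0$ for all integers $n\geq 1$; (d) $U/UP$ with $\alpha\neq-\frac{1}{q-q^{-1}}\left(\frac{q^{-2m}(1-q^{-2nm})}{1-q^{-2m}}\beta^{m}-\frac{q^{2m}(1-q^{2nm})}{1-q^{2m}}\beta^{-m}\right)$ for all integers $n\geq 0$ and $\alpha\neq\frac{1}{q-q^{-1}}\left(\frac{1-q^{2nm}}{1-q^{2m}}\beta^{m}-\frac{1-q^{-2nm}}{1-q^{-2m}}\beta^{-m}\right)$ for all integers $n\geq 1$.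
   Context: Let $q\in\mathbb{C}$ be nonzero and not a root of unity, and let $m\geq 1$ be an integer. Put $f_m(K)=\frac{K^{m}-K^{-m}}{q-q^{-1}}$. $U=U_q(f_m(K))$ is the associative unital $\mathbb{C}$-algebra generated by $E,F,K^{\pm1}$ with relations $KE=q^{2}EK$, $KF=q^{-2}FK$, $KK^{-1}=K^{-1}K=1$, $EF-FE=f_m(K)$. Let $\xi=EF$ and let $R$ be the (commutative) subalgebra of $U$ generated by $\xi,K^{\pm1}$. A weight representation of $U$ is a left $U$-module which is the direct sum of the eigenspaces of $K$. *)

theory Defs
  imports "HOL-Algebra.Algebra" "HOL-Algebra.Algebraic_Closure_Type" "HOL-Library.Poly_Mapping"
begin

section \<open>The free algebra and the algebra \<open>U\<^sub>q(f\<^sub>m(K))\<close>\<close>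

text \<open>
  Lists form the free monoid, written additively as the convolution product of
  \<^type>\<open>poly_mapping\<close> requires. Hence finitely supported functions from words to
  \<^typ>\<open>complex\<close> are the free unital algebra on the letters.
\<close>

instantiation list :: (type) monoid_add
begin

definition zero_list :: "'a list" where
  "zero_list = []"

definition plus_list :: "'a list \<Rightarrow> 'a list \<Rightarrow> 'a list" where
  "plus_list = (@)"

instance
  by standard (simp_all add: zero_list_def plus_list_def)

end

datatype gen = Gen_E | Gen_F | Gen_K | Gen_Kinv

type_synonym free_alg = "gen list \<Rightarrow>\<^sub>0 complex"

definition letter :: "gen \<Rightarrow> free_alg" where
  "letter g = Poly_Mapping.single [g] 1"

definition coef :: "complex \<Rightarrow> free_alg" where
  "coef c = Poly_Mapping.single [] c"

definition f_word :: "complex \<Rightarrow> nat \<Rightarrow> free_alg" where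
  "f_word q m = coef (1 / (q - inverse q)) * (letter Gen_K ^ m - letter Gen_Kinv ^ m)"

definition relators :: "complex \<Rightarrow> nat \<Rightarrow> free_alg set" where
  "relators q m =
    {letter Gen_K * letter Gen_E - coef (q\<^sup>2) * (letter Gen_E * letter Gen_K),
     letter Gen_K * letter Gen_F - coef (inverse (q\<^sup>2)) * (letter Gen_F * letter Gen_K),
     letter Gen_K * letter Gen_Kinv - 1,
     letter Gen_Kinv * letter Gen_K - 1,
     letter Gen_E * letter Gen_F - letter Gen_F * letter Gen_E - f_word q m}"

definition rel_ideal :: "complex \<Rightarrow> nat \<Rightarrow> free_alg set" where
  "rel_ideal q m = Idl\<^bsub>ring_of_type_algebra\<^esub> (relators q m)"

definition Uq :: "complex \<Rightarrow> nat \<Rightarrow> free_alg set ring" where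
  "Uq q m = ring_of_type_algebra Quot (rel_ideal q m)"

definition cls :: "complex \<Rightarrow> nat \<Rightarrow> free_alg \<Rightarrow> free_alg set" where
  "cls q m x = rel_ideal q m +>\<^bsub>ring_of_type_algebra\<^esub> x"

definition scal :: "complex \<Rightarrow> nat \<Rightarrow> complex \<Rightarrow> free_alg set" where
  "scal q m c = cls q m (coef c)"

definition uE :: "complex \<Rightarrow> nat \<Rightarrow> free_alg set" where
  "uE q m = cls q m (letter Gen_E)"

definition uF :: "complex \<Rightarrow> nat \<Rightarrow> free_alg set" where
  "uF q m = cls q m (letter Gen_F)"

definition uK :: "complex \<Rightarrow> nat \<Rightarrow> free_alg set" where
  "uK q m = cls q m (letter Gen_K)"

definition uKinv :: "complex \<Rightarrow> nat \<Rightarrow> free_alg set" where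
  "uKinv q m = cls q m (letter Gen_Kinv)"

definition xi :: "complex \<Rightarrow> nat \<Rightarrow> free_alg set" where
  "xi q m = uE q m \<otimes>\<^bsub>Uq q m\<^esub> uF q m"

text \<open>
  The subalgebra \<open>R\<close> is the subring generated by the scalars together with
  \<open>\<xi>\<close>, \<open>K\<close>, \<open>K\<^sup>-\<^sup>1\<close>; the ideal \<open>P\<close> is taken in \<open>R\<close>, not in \<open>U\<close>.
\<close>

definition R_ring :: "complex \<Rightarrow> nat \<Rightarrow> free_alg set ring" where
  "R_ring q m = (Uq q m)\<lparr>carrier :=
     generate_ring (Uq q m) (range (scal q m) \<union> {xi q m, uK q m, uKinv q m})\<rparr>"

definition P_ideal :: "complex \<Rightarrow> nat \<Rightarrow> complex \<Rightarrow> complex \<Rightarrow> free_alg set set" where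
  "P_ideal q m \<alpha> \<beta> = Idl\<^bsub>R_ring q m\<^esub>
     {xi q m \<ominus>\<^bsub>Uq q m\<^esub> scal q m \<alpha>, uK q m \<ominus>\<^bsub>Uq q m\<^esub> scal q m \<beta>}"


section \<open>Left modules\<close>

text \<open>
  The locale \<^locale>\<open>module\<close> of HOL-Algebra assumes a commutative ring. We keep its record
  type (whose fields \<^const>\<open>monoid.mult\<close> and \<^const>\<open>one\<close> play no role for modules), its axioms
  and its notion of submodule, but allow an arbitrary ring.
\<close>

locale left_module = R?: ring R + M?: abelian_group M
  for R :: "('a, 'c) ring_scheme" and M :: "('a, 'v, 'd) module_scheme" (structure) +
  assumes smult_closed:
      "\<lbrakk>a \<in> carrier R; x \<in> carrier M\<rbrakk> \<Longrightarrow> a \<odot>\<^bsub>M\<^esub> x \<in> carrier M"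
    and smult_l_distr:
      "\<lbrakk>a \<in> carrier R; b \<in> carrier R; x \<in> carrier M\<rbrakk> \<Longrightarrow>
        (a \<oplus>\<^bsub>R\<^esub> b) \<odot>\<^bsub>M\<^esub> x = a \<odot>\<^bsub>M\<^esub> x \<oplus>\<^bsub>M\<^esub> b \<odot>\<^bsub>M\<^esub> x"
    and smult_r_distr:
      "\<lbrakk>a \<in> carrier R; x \<in> carrier M; y \<in> carrier M\<rbrakk> \<Longrightarrow>
        a \<odot>\<^bsub>M\<^esub> (x \<oplus>\<^bsub>M\<^esub> y) = a \<odot>\<^bsub>M\<^esub> x \<oplus>\<^bsub>M\<^esub> a \<odot>\<^bsub>M\<^esub> y"
    and smult_assoc:
      "\<lbrakk>a \<in> carrier R; b \<in> carrier R; x \<in> carrier M\<rbrakk> \<Longrightarrow>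
        (a \<otimes>\<^bsub>R\<^esub> b) \<odot>\<^bsub>M\<^esub> x = a \<odot>\<^bsub>M\<^esub> (b \<odot>\<^bsub>M\<^esub> x)"
    and smult_one:
      "x \<in> carrier M \<Longrightarrow> \<one>\<^bsub>R\<^esub> \<odot>\<^bsub>M\<^esub> x = x"

definition irreducible_module :: "('a, 'c) ring_scheme \<Rightarrow> ('a, 'v, 'd) module_scheme \<Rightarrow> bool" where
  "irreducible_module R M \<longleftrightarrow>
     left_module R M \<and> carrier M \<noteq> {\<zero>\<^bsub>M\<^esub>} \<and>
     (\<forall>H. submodule H R M \<longrightarrow> H = {\<zero>\<^bsub>M\<^esub>} \<or> H = carrier M)"

definition module_iso ::
  "('a, 'c) ring_scheme \<Rightarrow> ('a, 'v, 'd) module_scheme \<Rightarrow> ('a, 'w, 'e) module_scheme \<Rightarrow> bool" where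
  "module_iso R M N \<longleftrightarrow> (\<exists>h. bij_betw h (carrier M) (carrier N) \<and>
     (\<forall>x\<in>carrier M. \<forall>y\<in>carrier M. h (x \<oplus>\<^bsub>M\<^esub> y) = h x \<oplus>\<^bsub>N\<^esub> h y) \<and>
     (\<forall>a\<in>carrier R. \<forall>x\<in>carrier M. h (a \<odot>\<^bsub>M\<^esub> x) = a \<odot>\<^bsub>N\<^esub> h x))"

text \<open>The set \<open>R S\<close> of all finite sums of products \<open>r s\<close>, with \<open>r \<in> R\<close> and \<open>s \<in> S\<close>.\<close>

definition left_span :: "('a, 'c) ring_scheme \<Rightarrow> 'a set \<Rightarrow> 'a set" where
  "left_span R S = generate (add_monoid R) {r \<otimes>\<^bsub>R\<^esub> s | r s. r \<in> carrier R \<and> s \<in> S}"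

text \<open>
  The left module \<open>R / L\<close> for a left ideal \<open>L\<close>, in the style of \<^const>\<open>FactRing\<close>:
  the union in the scalar multiplication is over representatives.
\<close>

definition quot_module :: "('a, 'c) ring_scheme \<Rightarrow> 'a set \<Rightarrow> ('a, 'a set) module" where
  "quot_module R L =
     \<lparr>carrier = a_rcosets\<^bsub>R\<^esub> L, monoid.mult = undefined, one = undefined,
      ring.zero = L, add = set_add R,
      module.smult = (\<lambda>r A. \<Union>x\<in>A. L +>\<^bsub>R\<^esub> (r \<otimes>\<^bsub>R\<^esub> x))\<rparr>"

text \<open>
  \<open>M\<close> is the (internal) direct sum of the family \<open>W\<close>: every element is, in exactly one way, a
  sum of a finitely supported family with members in the \<open>W i\<close>.
\<close>

definition is_direct_sum :: "('v, 'd) ring_scheme \<Rightarrow> ('i \<Rightarrow> 'v set) \<Rightarrow> bool" where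
  "is_direct_sum M W \<longleftrightarrow>
     (\<forall>i. additive_subgroup (W i) M) \<and>
     (\<forall>v\<in>carrier M. \<exists>!w. (\<forall>i. w i \<in> W i) \<and> finite {i. w i \<noteq> \<zero>\<^bsub>M\<^esub>} \<and>
        v = (\<Oplus>\<^bsub>M\<^esub>i\<in>{i. w i \<noteq> \<zero>\<^bsub>M\<^esub>}. w i))"

definition weight_space ::
  "complex \<Rightarrow> nat \<Rightarrow> (free_alg set, 'v, 'd) module_scheme \<Rightarrow> complex \<Rightarrow> 'v set" where
  "weight_space q m V \<mu> = {v \<in> carrier V. uK q m \<odot>\<^bsub>V\<^esub> v = scal q m \<mu> \<odot>\<^bsub>V\<^esub> v}"

definition weight_rep ::
  "complex \<Rightarrow> nat \<Rightarrow> (free_alg set, 'v, 'd) module_scheme \<Rightarrow> bool" where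
  "weight_rep q m V \<longleftrightarrow> left_module (Uq q m) V \<and> is_direct_sum V (weight_space q m V)"

end

theory Submission
  imports Defs
begin

text \<open>
An irreducible module is generated by any of its nonzero vectors \<open>v\<close>, so it is \<open>U / L\<close> with
\<open>L\<close> the annihilator of \<open>v\<close>. The theorem is therefore a statement about left ideals: for a
well-chosen \<open>v\<close>, the annihilator is generated by the obvious elements, namely \<open>\<xi> - \<alpha>\<close>,
\<open>K - \<beta>\<close> and those powers of \<open>E\<close> and \<open>F\<close> that kill \<open>v\<close>.

All computations take place in the free algebra. The preimage there of the annihilator of \<open>v\<close> is a
left ideal \<open>N\<close> containing all \<open>r x\<close> with \<open>r\<close> a defining relator, and a congruence
\<open>x \<approx> y\<close> modulo \<open>N\<close> says that \<open>x v = y v\<close>. In this language the preimage of the left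
ideal that a case of the theorem prescribes is an \<open>N\<close> of the same kind, so that one computation
serves both the given module and the quotient it is compared with.

\<^item> Every \<open>a v\<close> is a combination of the vectors \<open>E^i v\<close> and \<open>F^i v\<close> with coefficients
  that are polynomials in \<open>\<xi>\<close> acting on \<open>v\<close>, because \<open>E F^(k+1) v\<close> and \<open>F E^(k+1) v\<close>
  come back to \<open>F^k\<close> and \<open>E^k\<close> times a linear polynomial in \<open>\<xi>\<close>
  (\<open>E_F_ladder_cong\<close>, \<open>F_E_ladder_cong\<close>, \<open>xi_span_UNIV\<close>). These vectors have the weights
  \<open>q^(2i) \<beta>\<close>, which are pairwise different since \<open>q\<close> is not a root of unity, so they are
  independent wherever they do not vanish (\<open>weight_separation\<close>). Consequently a left ideal
  \<open>L \<subseteq> N\<close> containing \<open>\<xi> - \<alpha>\<close> and \<open>K - \<beta>\<close> equals \<open>N\<close> as soon as it contains every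
  \<open>E^i\<close> and \<open>F^i\<close> lying in \<open>N\<close> (\<open>eq_of_ladder\<close>).

\<^item> Irreducibility makes \<open>N\<close> maximal. Expressing \<open>v\<close> through \<open>\<xi> v\<close> gives a nonzero polynomial in
  \<open>\<xi>\<close> that kills \<open>v\<close>, and splitting it into linear factors yields a common eigenvector of \<open>K\<close>
  and \<open>\<xi>\<close> (\<open>xi_eigenvector\<close>). This is Schur's lemma for the weight spaces, in which
  \<open>\<xi>\<close> acts irreducibly.

\<^item> If some nonzero weight vector is killed by \<open>E\<close>, it is taken for \<open>v\<close>, which leads to (a) and (b);
  otherwise one killed by \<open>F\<close> is taken, which leads to (c); otherwise any common eigenvector will do,
  and no power of \<open>E\<close> or \<open>F\<close> kills it, which is (d). The numerical conditions on \<open>\<alpha>\<close> and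
  \<open>\<beta>\<close> express exactly which powers vanish: in an irreducible module a vector \<open>F^(k+1) v\<close> killed
  by \<open>E\<close> must itself be zero, because the submodule it generates lies in weights below that of
  \<open>v\<close>. Hence \<open>F^(k+1) v\<close> vanishes if and only if the scalar by which \<open>E F^(k+1) v\<close> differs
  from \<open>F^k v\<close> does (\<open>F_power_Suc_mem_iff\<close>), and likewise for \<open>E\<close>. These scalars are
  sums of values of \<open>f\<close>, evaluated as geometric series in \<open>q^(2m)\<close>.
\<close>

section \<open>Scalars and words in the free algebra\<close>

abbreviation E :: free_alg where "E \<equiv> letter Gen_E"
abbreviation F :: free_alg where "F \<equiv> letter Gen_F"
abbreviation K :: free_alg where "K \<equiv> letter Gen_K"
abbreviation Kinv :: free_alg where "Kinv \<equiv> letter Gen_Kinv"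

lemma one_eq_single_Nil: "(1 :: free_alg) = Poly_Mapping.single [] 1"
  by (simp add: zero_list_def [symmetric])

lemma coef_0 [simp]: "coef 0 = 0"
  and coef_1 [simp]: "coef 1 = 1"
  and coef_add: "coef (a + b) = coef a + coef b"
  and coef_minus: "coef (- a) = - coef a"
  and coef_diff: "coef (a - b) = coef a - coef b"
  by (simp_all add: coef_def single_add single_uminus single_diff one_eq_single_Nil)

lemma coef_mult: "coef (a * b) = coef a * coef b"
  by (simp add: coef_def mult_single plus_list_def)

lemma coef_sum: "coef (sum f A) = (\<Sum>i\<in>A. coef (f i))"
  by (induction A rule: infinite_finite_induct) (simp_all add: coef_add)

text \<open>
The letters and scalars generate the free algebra, in the form suited to left modules: every element
is reached from scalars by left multiplication with letters and by addition.
\<close>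

lemma free_alg_induct [case_names scalar letter add]:
  fixes P :: "free_alg \<Rightarrow> bool"
  assumes scalar: "\<And>c. P (coef c)"
    and letter: "\<And>g x. P x \<Longrightarrow> P (letter g * x)"
    and add: "\<And>x y. P x \<Longrightarrow> P y \<Longrightarrow> P (x + y)"
  shows "P x"
proof (induction x rule: update_induct)
  case const
  then show ?case using scalar[of 0] by simp
next
  case (update f w c)
  have "P (Poly_Mapping.single w c)"
  proof (induction w)
    case Nil
    then show ?case using scalar[of c] by (simp add: coef_def)
  next
    case (Cons g w)
    have "Poly_Mapping.single (g # w) c = letter g * Poly_Mapping.single w c"
      by (simp add: letter_def mult_single plus_list_def)
    then show ?case using letter[OF Cons] by simp
  qed
  moreover have "Poly_Mapping.update w c f = f + Poly_Mapping.single w c"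
    using update by (intro poly_mapping_eqI)
      (auto simp: lookup_update lookup_add lookup_single in_keys_iff)
  ultimately show ?case using add update by simp
qed

lemma coef_commute: "coef c * x = x * coef c"
proof (induction x rule: free_alg_induct)
  case (scalar d)
  then show ?case by (simp add: coef_mult [symmetric] mult.commute)
next
  case (letter g x)
  have "coef c * letter g = letter g * coef c"
    by (simp add: coef_def letter_def mult_single plus_list_def)
  then have "coef c * (letter g * x) = letter g * (coef c * x)"
    by (simp add: mult.assoc [symmetric])
  then show ?case by (simp add: letter mult.assoc)
qed (simp add: algebra_simps)

lemma coef_left_commute: "x * (coef c * y) = coef c * (x * y)"
  by (metis coef_commute mult.assoc)

text \<open>
As a rewrite rule the general law would loop when both factors are scalars; these instances move
scalars in front of letters only.
\<close>

lemmas coef_to_front =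
  coef_left_commute [of "letter g" for g] coef_left_commute [of "letter g ^ k" for g k]

section \<open>Congruence, weights and polynomials in \<open>\<xi>\<close>\<close>

text \<open>
If \<open>N\<close> is the annihilator of a vector \<open>v\<close>, then \<open>x \<approx> y\<close> modulo \<open>N\<close> means
\<open>x v = y v\<close>, and \<open>of_weight N x \<mu>\<close> means \<open>K x v = \<mu> x v\<close>, with \<open>x v = 0\<close> allowed.
\<close>

definition cong_mod :: "free_alg \<Rightarrow> free_alg set \<Rightarrow> free_alg \<Rightarrow> bool"
    (\<open>(_ \<approx>\<^bsub>_\<^esub> _)\<close> [51, 0, 51] 50)
  where "x \<approx>\<^bsub>N\<^esub> y \<longleftrightarrow> x - y \<in> N"

definition of_weight :: "free_alg set \<Rightarrow> free_alg \<Rightarrow> complex \<Rightarrow> bool"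
  where "of_weight N x \<mu> \<longleftrightarrow> K * x \<approx>\<^bsub>N\<^esub> coef \<mu> * x"

definition f_val :: "complex \<Rightarrow> nat \<Rightarrow> complex \<Rightarrow> complex"
  where "f_val q m \<mu> = (\<mu> ^ m - inverse \<mu> ^ m) / (q - inverse q)"

text \<open>
The index is the degree in the grading of \<open>U\<close> with \<open>E\<close> in degree \<open>1\<close> and
\<open>F\<close> in degree \<open>-1\<close>, so that the rung at \<open>i\<close> multiplies weights by \<open>q^(2i)\<close> in both
directions.
\<close>

definition ladder :: "int \<Rightarrow> free_alg"
  where "ladder i = (if 0 \<le> i then E ^ nat i else F ^ nat (- i))"

lemma ladder_pos: "0 < i \<Longrightarrow> ladder i = E ^ nat (i - 1) * E"
  by (simp add: ladder_def nat_diff_distrib flip: power_Suc2 power_Suc)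

lemma ladder_neg: "i \<le> 0 \<Longrightarrow> k \<le> nat (- i) \<Longrightarrow> ladder i = F ^ (nat (- i) - k) * F ^ k"
  by (cases "i = 0") (simp_all add: ladder_def flip: power_add)

lemmas ladder_coef = coef_left_commute [of "ladder i" for i]

text \<open>
Evaluation at \<open>\<xi> = E F\<close>, as a sum because the target is noncommutative.
\<close>

definition xi_poly :: "complex poly \<Rightarrow> free_alg"
  where "xi_poly p = (\<Sum>i\<le>degree p. coef (coeff p i) * (E * F) ^ i)"

lemma xi_poly_altdef:
  assumes "degree p \<le> n"
  shows "xi_poly p = (\<Sum>i\<le>n. coef (coeff p i) * (E * F) ^ i)"
  unfolding xi_poly_def
  by (rule sum.mono_neutral_left) (use assms in \<open>auto simp: coeff_eq_0\<close>)

lemma xi_poly_0 [simp]: "xi_poly 0 = 0"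
  by (simp add: xi_poly_def)

lemma xi_poly_add: "xi_poly (p + r) = xi_poly p + xi_poly r"
proof -
  let ?n = "max (degree p) (degree r)"
  show ?thesis
    using xi_poly_altdef[of p ?n] xi_poly_altdef[of r ?n] xi_poly_altdef[of "p + r" ?n]
    by (simp add: degree_add_le_max coef_add distrib_right sum.distrib)
qed

lemma xi_poly_smult: "xi_poly (smult c p) = coef c * xi_poly p"
  using xi_poly_altdef[of "smult c p" "degree p"]
  by (simp add: degree_smult_le xi_poly_def coef_mult sum_distrib_left mult.assoc)

lemma xi_poly_const: "xi_poly [:c:] = coef c"
  by (simp add: xi_poly_def)

lemma xi_poly_shift: "xi_poly (pCons 0 p) = E * F * xi_poly p"
  and xi_poly_shift_right: "xi_poly (pCons 0 p) = xi_poly p * (E * F)"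
proof -
  have "xi_poly (pCons 0 p) = (\<Sum>i\<le>Suc (degree p). coef (coeff (pCons 0 p) i) * (E * F) ^ i)"
    by (rule xi_poly_altdef) (simp add: degree_pCons_le)
  also have "\<dots> = (\<Sum>i\<le>degree p. coef (coeff p i) * (E * F) ^ Suc i)"
    by (simp only: sum.atMost_Suc_shift coeff_pCons_0 coeff_pCons_Suc) simp
  finally have *: "xi_poly (pCons 0 p) = \<dots>" .
  show "xi_poly (pCons 0 p) = E * F * xi_poly p"
    unfolding * unfolding xi_poly_def sum_distrib_left
    by (intro sum.cong) (simp_all add: coef_left_commute [of "E * F"])
  show "xi_poly (pCons 0 p) = xi_poly p * (E * F)"
    unfolding * unfolding xi_poly_def sum_distrib_right
    by (intro sum.cong) (simp_all only: power_Suc2 mult.assoc)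
qed

lemma power_int_even: "x powi (2 * int k) = ((x :: complex)\<^sup>2) ^ k"
  by (metis of_nat_mult of_nat_numeral power_int_of_nat power_mult)

locale generic_parameter =
  fixes q :: complex and m :: nat
  assumes q_nonzero: "q \<noteq> 0"
    and q_not_root_of_unity: "\<And>k::nat. k \<ge> 1 \<Longrightarrow> q ^ k \<noteq> 1"
    and m_pos: "m \<ge> 1"
begin

text \<open>
The structure constants of the ladder: up to sign, the amounts by which the eigenvalue of \<open>\<xi>\<close> at a
vector of weight \<open>\<beta>\<close> is shifted after \<open>k\<close> steps up or down. Going up starts with the value of \<open>f\<close>
at \<open>\<beta>\<close> itself, going down with that at \<open>\<beta> / q\<^sup>2\<close>; the asymmetry comes from \<open>\<xi>\<close> being
\<open>E F\<close> and not \<open>F E\<close>.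
\<close>

definition f_up :: "complex \<Rightarrow> nat \<Rightarrow> complex"
  where "f_up \<beta> k = (\<Sum>i<k. f_val q m ((q\<^sup>2) ^ i * \<beta>))"

definition f_down :: "complex \<Rightarrow> nat \<Rightarrow> complex"
  where "f_down \<beta> k = (\<Sum>i<k. f_val q m (\<beta> / (q\<^sup>2) ^ Suc i))"

lemma power_int_q_eq_1: "q powi i = 1 \<longleftrightarrow> i = 0"
proof
  assume "q powi i = 1"
  then have "q ^ nat \<bar>i\<bar> = 1"
    by (cases "i \<ge> 0") (auto simp: power_int_def power_inverse)
  then show "i = 0" using q_not_root_of_unity[of "nat \<bar>i\<bar>"] by linarith
qed simp

lemma power_int_q_inj: "q powi i = q powi j \<longleftrightarrow> i = j"
  using power_int_q_eq_1[of "i - j"] q_nonzero by (auto simp: power_int_diff)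

end

section \<open>Left ideals containing the relations of \<open>U\<close>\<close>

text \<open>
Asking for \<open>r x \<in> N\<close> and not just \<open>r \<in> N\<close> makes \<open>N\<close> contain the two-sided ideal of
relations; such \<open>N\<close> are the preimages of the left ideals of \<open>U\<close>.
\<close>

locale U_left_ideal = generic_parameter +
  fixes N :: "free_alg set"
  assumes zero_mem: "0 \<in> N"
    and add_mem: "\<And>x y. x \<in> N \<Longrightarrow> y \<in> N \<Longrightarrow> x + y \<in> N"
    and mult_mem: "\<And>a x. x \<in> N \<Longrightarrow> a * x \<in> N"
    and relator_mem: "\<And>r x. r \<in> relators q m \<Longrightarrow> r * x \<in> N"
begin

lemma minus_mem: "x \<in> N \<Longrightarrow> - x \<in> N"
  using mult_mem[of x "- 1"] by simp

lemma diff_mem: "x \<in> N \<Longrightarrow> y \<in> N \<Longrightarrow> x - y \<in> N"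
  using add_mem[of x "- y"] minus_mem by simp

lemma sum_mem: "(\<And>i. i \<in> I \<Longrightarrow> x i \<in> N) \<Longrightarrow> sum x I \<in> N"
  by (induction I rule: infinite_finite_induct) (auto intro: zero_mem add_mem)

lemma cong_refl [simp]: "x \<approx>\<^bsub>N\<^esub> x"
  by (simp add: cong_mod_def zero_mem)

lemma cong_sym: "x \<approx>\<^bsub>N\<^esub> y \<Longrightarrow> y \<approx>\<^bsub>N\<^esub> x"
  using minus_mem[of "x - y"] by (simp add: cong_mod_def)

lemma cong_trans [trans]: "x \<approx>\<^bsub>N\<^esub> y \<Longrightarrow> y \<approx>\<^bsub>N\<^esub> z \<Longrightarrow> x \<approx>\<^bsub>N\<^esub> z"
  using add_mem[of "x - y" "y - z"] by (simp add: cong_mod_def)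

lemma cong_add: "x \<approx>\<^bsub>N\<^esub> y \<Longrightarrow> x' \<approx>\<^bsub>N\<^esub> y' \<Longrightarrow> x + x' \<approx>\<^bsub>N\<^esub> y + y'"
  using add_mem[of "x - y" "x' - y'"] by (simp add: cong_mod_def algebra_simps)

lemma cong_diff: "x \<approx>\<^bsub>N\<^esub> y \<Longrightarrow> x' \<approx>\<^bsub>N\<^esub> y' \<Longrightarrow> x - x' \<approx>\<^bsub>N\<^esub> y - y'"
  using diff_mem[of "x - y" "x' - y'"] by (simp add: cong_mod_def algebra_simps)

lemma cong_mult: "x \<approx>\<^bsub>N\<^esub> y \<Longrightarrow> a * x \<approx>\<^bsub>N\<^esub> a * y"
  using mult_mem[of "x - y" a] by (simp add: cong_mod_def algebra_simps)

lemma cong_sum: "(\<And>i. i \<in> I \<Longrightarrow> x i \<approx>\<^bsub>N\<^esub> y i) \<Longrightarrow> sum x I \<approx>\<^bsub>N\<^esub> sum y I"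
  by (induction I rule: infinite_finite_induct) (auto intro: cong_add)

lemma cong_mem: "x \<approx>\<^bsub>N\<^esub> y \<Longrightarrow> x \<in> N \<longleftrightarrow> y \<in> N"
  using add_mem[of "x - y" y] diff_mem[of x "x - y"] by (auto simp: cong_mod_def)

lemma cong_0_iff: "x \<approx>\<^bsub>N\<^esub> 0 \<longleftrightarrow> x \<in> N"
  by (simp add: cong_mod_def)

lemma coef_mult_mem_iff: "c \<noteq> 0 \<Longrightarrow> coef c * x \<in> N \<longleftrightarrow> x \<in> N"
  using mult_mem[of "coef c * x" "coef (inverse c)"] mult_mem[of x "coef c"]
  by (auto simp: mult.assoc [symmetric] coef_mult [symmetric])

lemma K_E_cong: "K * (E * x) \<approx>\<^bsub>N\<^esub> coef (q\<^sup>2) * (E * (K * x))"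
  using relator_mem[of "K * E - coef (q\<^sup>2) * (E * K)" x]
  by (simp add: relators_def cong_mod_def algebra_simps)

lemma K_F_cong: "K * (F * x) \<approx>\<^bsub>N\<^esub> coef (inverse (q\<^sup>2)) * (F * (K * x))"
  using relator_mem[of "K * F - coef (inverse (q\<^sup>2)) * (F * K)" x]
  by (simp add: relators_def cong_mod_def algebra_simps)

lemma Kinv_K_cong: "Kinv * (K * x) \<approx>\<^bsub>N\<^esub> x"
  using relator_mem[of "Kinv * K - 1" x] by (simp add: relators_def cong_mod_def algebra_simps)

lemma E_F_cong: "E * (F * x) \<approx>\<^bsub>N\<^esub> F * (E * x) + f_word q m * x"
  using relator_mem[of "E * F - F * E - f_word q m" x]
  by (simp add: relators_def cong_mod_def algebra_simps)

lemma of_weight_E: assumes "of_weight N x \<mu>" shows "of_weight N (E * x) (q\<^sup>2 * \<mu>)"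
proof -
  have "K * (E * x) \<approx>\<^bsub>N\<^esub> coef (q\<^sup>2) * (E * (K * x))" by (rule K_E_cong)
  also have "\<dots> \<approx>\<^bsub>N\<^esub> coef (q\<^sup>2) * (E * (coef \<mu> * x))"
    using assms unfolding of_weight_def by (intro cong_mult)
  also have "\<dots> = coef (q\<^sup>2 * \<mu>) * (E * x)"
    by (simp add: coef_to_front coef_mult mult.assoc)
  finally show ?thesis unfolding of_weight_def .
qed

lemma of_weight_F: assumes "of_weight N x \<mu>" shows "of_weight N (F * x) (\<mu> / q\<^sup>2)"
proof -
  have "K * (F * x) \<approx>\<^bsub>N\<^esub> coef (inverse (q\<^sup>2)) * (F * (K * x))" by (rule K_F_cong)
  also have "\<dots> \<approx>\<^bsub>N\<^esub> coef (inverse (q\<^sup>2)) * (F * (coef \<mu> * x))"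
    using assms unfolding of_weight_def by (intro cong_mult)
  also have "\<dots> = coef (inverse (q\<^sup>2) * \<mu>) * (F * x)"
    by (simp add: coef_to_front coef_mult mult.assoc)
  finally show ?thesis unfolding of_weight_def by (simp add: field_simps)
qed

lemma of_weight_coef: "of_weight N x \<mu> \<Longrightarrow> of_weight N (coef c * x) \<mu>"
  using cong_mult[of "K * x" "coef \<mu> * x" "coef c"]
  by (simp add: of_weight_def coef_to_front coef_left_commute[of "coef c"])

lemma of_weight_add: "of_weight N x \<mu> \<Longrightarrow> of_weight N y \<mu> \<Longrightarrow> of_weight N (x + y) \<mu>"
  using cong_add[of "K * x" "coef \<mu> * x" "K * y" "coef \<mu> * y"]
  by (simp add: of_weight_def algebra_simps)

lemma of_weight_E_F: "of_weight N x \<mu> \<Longrightarrow> of_weight N (E * F * x) \<mu>"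
  using of_weight_E[OF of_weight_F, of x \<mu>] q_nonzero by (simp add: mult.assoc)

lemma of_weight_xi_poly: "of_weight N x \<mu> \<Longrightarrow> of_weight N (xi_poly p * x) \<mu>"
proof (induction p)
  case 0
  then show ?case by (simp add: of_weight_def)
next
  case (pCons c p)
  have "xi_poly (pCons c p) * x = coef c * x + E * F * (xi_poly p * x)"
    using xi_poly_add[of "[:c:]" "pCons 0 p"]
    by (simp add: xi_poly_const xi_poly_shift algebra_simps)
  then show ?case using pCons by (simp add: of_weight_add of_weight_coef of_weight_E_F)
qed

lemma of_weight_E_power: "of_weight N x \<mu> \<Longrightarrow> of_weight N (E ^ k * x) ((q\<^sup>2) ^ k * \<mu>)"
  by (induction k) (auto simp: mult.assoc dest: of_weight_E)

lemma of_weight_F_power: "of_weight N x \<mu> \<Longrightarrow> of_weight N (F ^ k * x) (\<mu> / (q\<^sup>2) ^ k)"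
  by (induction k) (auto simp: mult.assoc field_simps dest: of_weight_F)

lemma of_weight_ladder: "of_weight N x \<mu> \<Longrightarrow> of_weight N (ladder i * x) (q powi (2 * i) * \<mu>)"
proof (cases "i \<ge> 0")
  case True
  then have "q powi (2 * i) = (q\<^sup>2) ^ nat i"
    by (simp add: power_int_def nat_mult_distrib power_mult)
  then show "of_weight N x \<mu> \<Longrightarrow> ?thesis"
    using True of_weight_E_power by (simp add: ladder_def)
next
  case False
  then have "q powi (2 * i) = inverse ((q\<^sup>2) ^ nat (- i))"
    by (simp add: power_int_def nat_mult_distrib power_mult flip: power_inverse mult_minus_right)
  then show "of_weight N x \<mu> \<Longrightarrow> ?thesis"
    using False of_weight_F_power[of x \<mu> "nat (- i)"] by (simp add: ladder_def field_simps)
qed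

lemma Kinv_cong:
  assumes "of_weight N x \<mu>" "\<mu> \<noteq> 0"
  shows "Kinv * x \<approx>\<^bsub>N\<^esub> coef (inverse \<mu>) * x"
proof -
  have "coef (inverse \<mu>) * x \<approx>\<^bsub>N\<^esub> coef (inverse \<mu>) * (Kinv * (K * x))"
    by (intro cong_mult cong_sym[OF Kinv_K_cong])
  also have "\<dots> \<approx>\<^bsub>N\<^esub> coef (inverse \<mu>) * (Kinv * (coef \<mu> * x))"
    using assms unfolding of_weight_def by (intro cong_mult)
  also have "\<dots> = Kinv * x"
    using assms by (simp add: coef_to_front) (simp add: mult.assoc [symmetric] coef_mult [symmetric])
  finally show ?thesis by (rule cong_sym)
qed

text \<open>
\<open>K\<close> is invertible, so \<open>0\<close> is not a weight.
\<close>

lemma weight_nonzero: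
  assumes "of_weight N x \<mu>" "x \<notin> N"
  shows "\<mu> \<noteq> 0"
proof
  assume "\<mu> = 0"
  then have "K * x \<in> N" using assms by (simp add: of_weight_def cong_0_iff)
  then show False using cong_mem[OF Kinv_K_cong, of x] mult_mem assms by blast
qed

lemma power_cong:
  assumes "y * x \<approx>\<^bsub>N\<^esub> coef c * x"
  shows "y ^ k * x \<approx>\<^bsub>N\<^esub> coef (c ^ k) * x"
proof (induction k)
  case (Suc k)
  have "y ^ Suc k * x = y * (y ^ k * x)" by (simp add: mult.assoc)
  also have "\<dots> \<approx>\<^bsub>N\<^esub> y * (coef (c ^ k) * x)" by (intro cong_mult Suc)
  also have "\<dots> = coef (c ^ k) * (y * x)" by (rule coef_left_commute)
  also have "\<dots> \<approx>\<^bsub>N\<^esub> coef (c ^ k) * (coef c * x)" by (intro cong_mult assms)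
  also have "\<dots> = coef (c ^ Suc k) * x"
    by (simp add: mult.assoc [symmetric] coef_mult [symmetric] mult.commute)
  finally show ?case .
qed simp

lemma f_word_cong:
  assumes "of_weight N x \<mu>" "\<mu> \<noteq> 0"
  shows "f_word q m * x \<approx>\<^bsub>N\<^esub> coef (f_val q m \<mu>) * x"
proof -
  let ?c = "1 / (q - inverse q)"
  have "f_word q m * x = coef ?c * (K ^ m * x - Kinv ^ m * x)"
    by (simp add: f_word_def mult.assoc left_diff_distrib)
  also have "\<dots> \<approx>\<^bsub>N\<^esub> coef ?c * (coef (\<mu> ^ m) * x - coef (inverse \<mu> ^ m) * x)"
    using assms Kinv_cong[OF assms] unfolding of_weight_def
    by (intro cong_mult cong_diff power_cong)
  also have "\<dots> = coef (f_val q m \<mu>) * x"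
    by (simp add: f_val_def mult.assoc [symmetric] coef_mult [symmetric]
        coef_diff [symmetric] left_diff_distrib [symmetric])
  finally show ?thesis .
qed

section \<open>Spanning and independence of the powers of \<open>E\<close> and \<open>F\<close>\<close>

text \<open>
Moving \<open>F\<close> past one more \<open>E\<close> costs the scalar by which \<open>f(K)\<close> acts on the current weight
vector. The eigenvalue of \<open>\<xi>\<close> is left open, so that the formula also serves to construct
eigenvectors of \<open>\<xi>\<close>.
\<close>

lemma F_E_ladder_cong:
  assumes "of_weight N x \<beta>" "\<beta> \<noteq> 0"
  shows "F * (E ^ Suc k * x) \<approx>\<^bsub>N\<^esub> E ^ k * ((E * F - coef (f_up \<beta> (Suc k))) * x)"
proof (induction k)
  case 0
  have "F * (E * x) \<approx>\<^bsub>N\<^esub> E * (F * x) - f_word q m * x"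
    using cong_sym[OF E_F_cong[of x]] by (simp add: cong_mod_def algebra_simps)
  also have "\<dots> \<approx>\<^bsub>N\<^esub> E * (F * x) - coef (f_val q m \<beta>) * x"
    by (intro cong_diff f_word_cong assms) simp
  finally show ?case by (simp add: f_up_def algebra_simps)
next
  case (Suc k)
  let ?y = "E ^ Suc k * x"
  have wt: "of_weight N ?y ((q\<^sup>2) ^ Suc k * \<beta>)" by (intro of_weight_E_power assms)
  have "F * (E * ?y) \<approx>\<^bsub>N\<^esub> E * (F * ?y) - f_word q m * ?y"
    using cong_sym[OF E_F_cong[of ?y]] by (simp add: cong_mod_def algebra_simps)
  also have "\<dots> \<approx>\<^bsub>N\<^esub> E * (E ^ k * ((E * F - coef (f_up \<beta> (Suc k))) * x))
      - coef (f_val q m ((q\<^sup>2) ^ Suc k * \<beta>)) * ?y"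
    using q_nonzero assms by (intro cong_diff cong_mult Suc f_word_cong wt) simp
  also have "\<dots> = E ^ Suc k * ((E * F - coef (f_up \<beta> (Suc (Suc k)))) * x)"
    by (simp add: f_up_def coef_add algebra_simps coef_to_front)
  finally show ?case by (simp add: mult.assoc)
qed

lemma E_F_ladder_cong:
  assumes "of_weight N x \<beta>" "\<beta> \<noteq> 0"
  shows "E * (F ^ Suc k * x) \<approx>\<^bsub>N\<^esub> F ^ k * ((E * F + coef (f_down \<beta> k)) * x)"
proof (induction k)
  case (Suc k)
  let ?y = "F ^ Suc k * x"
  have wt: "of_weight N ?y (\<beta> / (q\<^sup>2) ^ Suc k)" by (intro of_weight_F_power assms)
  have "E * (F * ?y) \<approx>\<^bsub>N\<^esub> F * (E * ?y) + f_word q m * ?y" by (rule E_F_cong)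
  also have "\<dots> \<approx>\<^bsub>N\<^esub> F * (F ^ k * ((E * F + coef (f_down \<beta> k)) * x))
      + coef (f_val q m (\<beta> / (q\<^sup>2) ^ Suc k)) * ?y"
    using q_nonzero assms by (intro cong_add cong_mult Suc f_word_cong wt) simp
  also have "\<dots> = F ^ Suc k * ((E * F + coef (f_down \<beta> (Suc k))) * x)"
    by (simp add: f_down_def coef_add algebra_simps coef_to_front)
  finally show ?case by (simp add: mult.assoc)
qed (simp add: f_down_def mult.assoc)

text \<open>
Applying \<open>K - \<mu> j\<close> removes the summand \<open>w j\<close> and only rescales \<open>x\<close> and the other
summands, by a nonzero factor in the case of \<open>x\<close>.
\<close>

lemma weight_separation:
  assumes "finite I" "of_weight N x \<beta>"
    and "\<And>i. i \<in> I \<Longrightarrow> of_weight N (w i) (\<mu> i)"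
    and "\<And>i. i \<in> I \<Longrightarrow> \<mu> i \<noteq> \<beta>"
    and "x \<approx>\<^bsub>N\<^esub> sum w I"
  shows "x \<in> N"
  using assms
proof (induction I arbitrary: x w rule: finite_induct)
  case empty
  then show ?case by (simp add: cong_0_iff)
next
  case (insert j I)
  have shift: "(K - coef (\<mu> j)) * y \<approx>\<^bsub>N\<^esub> coef (\<nu> - \<mu> j) * y" if "of_weight N y \<nu>" for y \<nu>
    using that cong_diff[of "K * y" "coef \<nu> * y" "coef (\<mu> j) * y" "coef (\<mu> j) * y"]
    by (simp add: of_weight_def algebra_simps coef_diff)
  \<comment> \<open>Apply \<open>K - \<mu> j\<close> to both sides.\<close>
  have "coef (\<beta> - \<mu> j) * x \<approx>\<^bsub>N\<^esub> (K - coef (\<mu> j)) * x"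
    by (rule cong_sym[OF shift[OF insert.prems(1)]])
  also have "\<dots> \<approx>\<^bsub>N\<^esub> (K - coef (\<mu> j)) * sum w (insert j I)"
    by (rule cong_mult[OF insert.prems(4)])
  also have "\<dots> = (\<Sum>i\<in>insert j I. (K - coef (\<mu> j)) * w i)" by (rule sum_distrib_left)
  also have "\<dots> \<approx>\<^bsub>N\<^esub> (\<Sum>i\<in>insert j I. coef (\<mu> i - \<mu> j) * w i)"
    by (intro cong_sum shift insert.prems)
  also have "\<dots> = (\<Sum>i\<in>I. coef (\<mu> i - \<mu> j) * w i)" using insert.hyps by simp
  finally have "coef (\<beta> - \<mu> j) * x \<in> N"
    by (intro insert.IH[of _ "\<lambda>i. coef (\<mu> i - \<mu> j) * w i"])
       (use insert.prems in \<open>auto intro: of_weight_coef\<close>)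
  then show ?case using insert.prems(3)[of j] coef_mult_mem_iff[of "\<beta> - \<mu> j" x] by auto
qed

text \<open>
Requiring the coefficients to vanish outside the finite index set makes the index sets of two
expansions freely enlargeable, and lets the coefficient at \<open>0\<close> be named without a case
distinction.
\<close>

definition xi_span :: "free_alg \<Rightarrow> free_alg set"
  where "xi_span x = {y. \<exists>I p. finite I \<and> (\<forall>i. i \<notin> I \<longrightarrow> p i = 0) \<and>
    y \<approx>\<^bsub>N\<^esub> (\<Sum>i\<in>I. ladder i * (xi_poly (p i) * x))}"

lemma xi_span_cong: "y \<approx>\<^bsub>N\<^esub> z \<Longrightarrow> z \<in> xi_span x \<Longrightarrow> y \<in> xi_span x"
  unfolding xi_span_def by (blast intro: cong_trans)

lemma ladder_in_xi_span: "ladder i * (xi_poly p * x) \<in> xi_span x"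
  unfolding xi_span_def
  by (intro CollectI exI[of _ "{i}"] exI[of _ "(\<lambda>_. 0)(i := p)"]) simp

lemma xi_span_add:
  assumes "y \<in> xi_span x" "z \<in> xi_span x"
  shows "y + z \<in> xi_span x"
proof -
  from assms obtain I p J r where I: "finite I" "\<And>i. i \<notin> I \<Longrightarrow> p i = 0"
      "y \<approx>\<^bsub>N\<^esub> (\<Sum>i\<in>I. ladder i * (xi_poly (p i) * x))"
    and J: "finite J" "\<And>i. i \<notin> J \<Longrightarrow> r i = 0"
      "z \<approx>\<^bsub>N\<^esub> (\<Sum>i\<in>J. ladder i * (xi_poly (r i) * x))"
    unfolding xi_span_def by blast
  have "(\<Sum>i\<in>I. ladder i * (xi_poly (p i) * x)) = (\<Sum>i\<in>I\<union>J. ladder i * (xi_poly (p i) * x))"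
    and "(\<Sum>i\<in>J. ladder i * (xi_poly (r i) * x)) = (\<Sum>i\<in>I\<union>J. ladder i * (xi_poly (r i) * x))"
    using I J by (auto intro!: sum.mono_neutral_left)
  with cong_add[OF I(3) J(3)]
  have "y + z \<approx>\<^bsub>N\<^esub> (\<Sum>i\<in>I\<union>J. ladder i * (xi_poly (p i + r i) * x))"
    by (simp add: xi_poly_add distrib_left distrib_right sum.distrib)
  then show ?thesis
    unfolding xi_span_def using I J
    by (intro CollectI exI[of _ "I \<union> J"] exI[of _ "\<lambda>i. p i + r i"]) auto
qed

lemma xi_span_sum: "(\<And>i. i \<in> I \<Longrightarrow> y i \<in> xi_span x) \<Longrightarrow> sum y I \<in> xi_span x"
proof (induction I rule: infinite_finite_induct)
  case (insert i I)
  then show ?case by (simp add: xi_span_add)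
qed (use ladder_in_xi_span[of 0 0] in simp_all)

text \<open>
Each letter maps a rung of the ladder to a neighbouring one: outwards by definition, inwards by the
two ladder formulas, whose linear factor in \<open>\<xi>\<close> is absorbed into the polynomial. \<open>K\<close> and its
inverse act on a rung by scalars.
\<close>

lemma letter_ladder_in_xi_span:
  assumes x: "of_weight N x \<beta>" "\<beta> \<noteq> 0"
  shows "letter g * (ladder i * (xi_poly p * x)) \<in> xi_span x"
proof -
  let ?y = "xi_poly p * x"
  have y: "of_weight N ?y \<beta>" using x by (intro of_weight_xi_poly)
  have scaled: "coef c * (ladder i * ?y) \<in> xi_span x" for c
    using ladder_in_xi_span[of i "smult c p" x]
    by (simp add: xi_poly_smult ladder_coef mult.assoc)
  have L: "of_weight N (ladder i * ?y) (q powi (2 * i) * \<beta>)" by (intro of_weight_ladder y)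
  show ?thesis
  proof (cases g)
    case Gen_K
    then show ?thesis using xi_span_cong[OF L[unfolded of_weight_def] scaled] by simp
  next
    case Gen_Kinv
    then show ?thesis using xi_span_cong[OF Kinv_cong[OF L] scaled] x q_nonzero by simp
  next
    case Gen_E
    show ?thesis
    proof (cases "i \<ge> 0")
      case True
      then have "E * (ladder i * ?y) = ladder (i + 1) * ?y"
        by (simp add: ladder_def nat_add_distrib mult.assoc)
      then show ?thesis using Gen_E ladder_in_xi_span by simp
    next
      case False
      \<comment> \<open>\<open>i < 0\<close>, so that \<open>E\<close> leads inwards and the ladder formula applies.\<close>
      define k where "k = nat (- i - 1)"
      have k: "ladder i = F ^ Suc k" "F ^ k = ladder (i + 1)"
        using False by (auto simp: ladder_def k_def simp flip: power_Suc) (simp add: Suc_nat_eq_nat_zadd1)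
      have "(E * F + coef c) * ?y = xi_poly (pCons 0 p + smult c p) * x" for c
        by (simp add: xi_poly_add xi_poly_smult xi_poly_shift algebra_simps)
      then have "F ^ k * ((E * F + coef (f_down \<beta> k)) * ?y) \<in> xi_span x"
        using ladder_in_xi_span k by simp
      then have "E * (F ^ Suc k * ?y) \<in> xi_span x"
        by (rule xi_span_cong[OF E_F_ladder_cong[OF y x(2)]])
      then show ?thesis using k(1) Gen_E by simp
    qed
  next
    case Gen_F
    show ?thesis
    proof (cases "i \<le> 0")
      case True
      then have "nat (1 - i) = Suc (nat (- i))" by simp
      then have "F * (ladder i * ?y) = ladder (i - 1) * ?y"
        using True by (cases "i = 0") (simp_all add: ladder_def mult.assoc)
      then show ?thesis using Gen_F ladder_in_xi_span by simp
    next
      case False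
      define k where "k = nat (i - 1)"
      have k: "ladder i = E ^ Suc k" "E ^ k = ladder (i - 1)"
        using False by (auto simp: ladder_def k_def simp flip: power_Suc) (simp add: Suc_nat_eq_nat_zadd1)
      have "(E * F - coef c) * ?y = xi_poly (pCons 0 p + smult (- c) p) * x" for c
        by (simp only: xi_poly_add xi_poly_smult xi_poly_shift coef_minus) (simp add: algebra_simps)
      then have "E ^ k * ((E * F - coef (f_up \<beta> (Suc k))) * ?y) \<in> xi_span x"
        using ladder_in_xi_span k by simp
      then have "F * (E ^ Suc k * ?y) \<in> xi_span x"
        by (rule xi_span_cong[OF F_E_ladder_cong[OF y x(2)]])
      then show ?thesis using k(1) Gen_F by simp
    qed
  qed
qed

lemma xi_span_UNIV:
  assumes x: "of_weight N x \<beta>" "\<beta> \<noteq> 0"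
  shows "a * x \<in> xi_span x"
proof (induction a rule: free_alg_induct)
  case (scalar c)
  then show ?case using ladder_in_xi_span[of 0 "[:c:]" x] by (simp add: ladder_def xi_poly_const)
next
  case (letter g a)
  then obtain I p where I: "finite I" "a * x \<approx>\<^bsub>N\<^esub> (\<Sum>i\<in>I. ladder i * (xi_poly (p i) * x))"
    unfolding xi_span_def by blast
  have "letter g * (a * x) \<approx>\<^bsub>N\<^esub> (\<Sum>i\<in>I. letter g * (ladder i * (xi_poly (p i) * x)))"
    using cong_mult[OF I(2), of "letter g"] by (simp only: sum_distrib_left)
  moreover have "(\<Sum>i\<in>I. letter g * (ladder i * (xi_poly (p i) * x))) \<in> xi_span x"
    by (intro xi_span_sum letter_ladder_in_xi_span[OF x])
  ultimately show ?case using xi_span_cong by (simp add: mult.assoc)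
qed (simp add: distrib_right xi_span_add)

lemma xi_poly_eigen:
  assumes "E * F * x \<approx>\<^bsub>N\<^esub> coef \<alpha> * x"
  shows "xi_poly p * x \<approx>\<^bsub>N\<^esub> coef (poly p \<alpha>) * x"
proof -
  have "xi_poly p * x = (\<Sum>i\<le>degree p. coef (coeff p i) * ((E * F) ^ i * x))"
    by (simp add: xi_poly_def sum_distrib_right mult.assoc)
  also have "\<dots> \<approx>\<^bsub>N\<^esub> (\<Sum>i\<le>degree p. coef (coeff p i) * (coef (\<alpha> ^ i) * x))"
    by (intro cong_sum cong_mult power_cong assms)
  also have "\<dots> = coef (poly p \<alpha>) * x"
    by (simp add: poly_altdef coef_sum coef_mult sum_distrib_right mult.assoc)
  finally show ?thesis .
qed

lemma ladder_expansion:
  assumes x: "of_weight N x \<beta>" "\<beta> \<noteq> 0" and xi: "E * F * x \<approx>\<^bsub>N\<^esub> coef \<alpha> * x"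
  obtains I c where "finite I" "a * x \<approx>\<^bsub>N\<^esub> (\<Sum>i\<in>I. coef (c i) * (ladder i * x))"
proof -
  obtain I p where I: "finite I" "a * x \<approx>\<^bsub>N\<^esub> (\<Sum>i\<in>I. ladder i * (xi_poly (p i) * x))"
    using xi_span_UNIV[OF x, of a] unfolding xi_span_def by blast
  note I(2)
  also have "(\<Sum>i\<in>I. ladder i * (xi_poly (p i) * x))
      \<approx>\<^bsub>N\<^esub> (\<Sum>i\<in>I. ladder i * (coef (poly (p i) \<alpha>) * x))"
    by (intro cong_sum cong_mult xi_poly_eigen xi)
  finally show thesis using I(1) that[of I "\<lambda>i. poly (p i) \<alpha>"] by (simp add: ladder_coef)
qed

lemma ladder_independent:
  assumes x: "of_weight N x \<beta>" "\<beta> \<noteq> 0"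
    and I: "finite I" "(\<Sum>i\<in>I. coef (c i) * (ladder i * x)) \<in> N" "j \<in> I"
  shows "coef (c j) * (ladder j * x) \<in> N"
proof (rule weight_separation[of "I - {j}" _ "q powi (2 * j) * \<beta>"
      "\<lambda>i. coef (- c i) * (ladder i * x)" "\<lambda>i. q powi (2 * i) * \<beta>"])
  show "coef (c j) * (ladder j * x) \<approx>\<^bsub>N\<^esub> (\<Sum>i\<in>I - {j}. coef (- c i) * (ladder i * x))"
    using I by (simp add: cong_mod_def coef_minus sum_negf sum_diff1)
qed (use I x in \<open>auto simp: power_int_q_inj intro: of_weight_coef of_weight_ladder\<close>)

section \<open>Comparison of left ideals\<close>

text \<open>
Modulo \<open>L\<close>, any element of \<open>N\<close> is a linear combination of rungs. Since \<open>L \<subseteq> N\<close>, this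
combination lies in \<open>N\<close>, so by independence its rungs outside \<open>N\<close> have coefficient zero; the
remaining ones lie in \<open>L\<close> by assumption.
\<close>

lemma eq_of_ladder:
  assumes L: "U_left_ideal q m L" "L \<subseteq> N"
    and gens: "K - coef \<beta> \<in> L" "E * F - coef \<alpha> \<in> L" and "\<beta> \<noteq> 0"
    and lad: "\<And>i. ladder i \<in> L \<or> ladder i \<notin> N"
  shows "L = N"
proof
  interpret L: U_left_ideal q m L by fact
  have wtL: "of_weight L 1 \<beta>" and xi: "E * F * 1 \<approx>\<^bsub>L\<^esub> coef \<alpha> * 1"
    using gens by (simp_all add: of_weight_def cong_mod_def)
  then have wtN: "of_weight N 1 \<beta>" using L by (auto simp: of_weight_def cong_mod_def)
  show "N \<subseteq> L"
  proof
    fix a assume "a \<in> N"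
    obtain I c where I: "finite I" "a * 1 \<approx>\<^bsub>L\<^esub> (\<Sum>i\<in>I. coef (c i) * (ladder i * 1))"
      by (rule L.ladder_expansion[OF wtL \<open>\<beta> \<noteq> 0\<close> xi])
    then have "a * 1 \<approx>\<^bsub>N\<^esub> (\<Sum>i\<in>I. coef (c i) * (ladder i * 1))"
      using L by (auto simp: cong_mod_def)
    with \<open>a \<in> N\<close> have N: "(\<Sum>i\<in>I. coef (c i) * (ladder i * 1)) \<in> N"
      using cong_mem by auto
    have "coef (c i) * (ladder i * 1) \<in> L" if "i \<in> I" for i
    proof (cases "ladder i \<in> L")
      case False
      then have "ladder i \<notin> N" using lad by blast
      then have "c i = 0"
        using ladder_independent[OF wtN \<open>\<beta> \<noteq> 0\<close> I(1) N that] coef_mult_mem_iff[of "c i"] by auto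
      then show ?thesis by (simp add: L.zero_mem)
    qed (simp add: L.mult_mem)
    then show "a \<in> L" using L.cong_mem[OF I(2)] L.sum_mem[of I "\<lambda>i. coef (c i) * (ladder i * 1)"]
      by simp
  qed
qed (use L in auto)

end

section \<open>Maximal left ideals\<close>

text \<open>
The annihilators of nonzero vectors in an irreducible module: \<open>x v \<noteq> 0\<close> implies that some
\<open>a\<close> takes \<open>x v\<close> back to \<open>v\<close>.
\<close>

locale maximal_U_left_ideal = U_left_ideal +
  assumes one_notin: "1 \<notin> N"
    and maximal: "\<And>x. x \<notin> N \<Longrightarrow> \<exists>a. a * x \<approx>\<^bsub>N\<^esub> 1"
begin

text \<open>
Since \<open>z v\<close> generates the module, the rungs above and below it span, and only those of the weight of \<open>v\<close> can
contribute to \<open>v\<close>.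
\<close>

lemma ladder_reaches_generator:
  assumes one: "of_weight N 1 \<beta>" and z: "z \<notin> N" "of_weight N z \<mu>"
    and xi: "E * F * z \<approx>\<^bsub>N\<^esub> coef \<alpha> * z"
  shows "\<exists>i. ladder i * z \<notin> N \<and> q powi (2 * i) * \<mu> = \<beta>"
proof (rule ccontr)
  assume *: "\<not> ?thesis"
  have "\<mu> \<noteq> 0" using weight_nonzero z by blast
  obtain a where a: "a * z \<approx>\<^bsub>N\<^esub> 1" using maximal z by blast
  obtain I c where I: "finite I" "a * z \<approx>\<^bsub>N\<^esub> (\<Sum>i\<in>I. coef (c i) * (ladder i * z))"
    by (rule ladder_expansion[OF z(2) \<open>\<mu> \<noteq> 0\<close> xi])
  \<comment> \<open>Rungs of the weight of the generator lie in \<open>N\<close> by assumption, so only the others remain.\<close>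
  let ?J = "{i \<in> I. q powi (2 * i) * \<mu> \<noteq> \<beta>}"
  note cong_sym[OF a]
  also note I(2)
  also have "(\<Sum>i\<in>I. coef (c i) * (ladder i * z))
      = (\<Sum>i\<in>?J. coef (c i) * (ladder i * z)) + (\<Sum>i\<in>I - ?J. coef (c i) * (ladder i * z))"
    using I(1) by (subst sum.union_disjoint [symmetric]) (auto intro: sum.cong)
  also have "\<dots> \<approx>\<^bsub>N\<^esub> (\<Sum>i\<in>?J. coef (c i) * (ladder i * z)) + 0"
  proof (intro cong_add cong_refl)
    have "ladder i * z \<in> N" if "i \<in> I - ?J" for i using * that by blast
    then show "(\<Sum>i\<in>I - ?J. coef (c i) * (ladder i * z)) \<approx>\<^bsub>N\<^esub> 0"
      unfolding cong_0_iff by (blast intro: sum_mem mult_mem)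
  qed
  finally have "1 \<in> N"
    using I(1) one z
    by (intro weight_separation[of ?J 1 \<beta> "\<lambda>i. coef (c i) * (ladder i * z)"
          "\<lambda>i. q powi (2 * i) * \<mu>"])
      (auto intro: of_weight_coef of_weight_ladder)
  then show False using one_notin by simp
qed

lemma E_killed_xi:
  assumes "of_weight N z \<mu>" "\<mu> \<noteq> 0" "E * z \<in> N"
  shows "E * F * z \<approx>\<^bsub>N\<^esub> coef (f_val q m \<mu>) * z"
proof -
  have "E * (F * z) \<approx>\<^bsub>N\<^esub> F * (E * z) + f_word q m * z" by (rule E_F_cong)
  also have "\<dots> \<approx>\<^bsub>N\<^esub> 0 + coef (f_val q m \<mu>) * z"
    using assms by (intro cong_add f_word_cong) (simp_all add: cong_0_iff mult_mem)
  finally show ?thesis by (simp add: mult.assoc)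
qed

text \<open>
Below a vector killed by \<open>E\<close> one only gets further down, and never back to the weight of the
generator.
\<close>

lemma E_F_power_notin:
  assumes one: "of_weight N 1 \<beta>" and "F ^ Suc k \<notin> N"
  shows "E * F ^ Suc k \<notin> N"
proof
  assume E: "E * F ^ Suc k \<in> N"
  have "\<beta> \<noteq> 0" using weight_nonzero one one_notin by blast
  have wt: "of_weight N (F ^ Suc k) (\<beta> / (q\<^sup>2) ^ Suc k)"
    using of_weight_F_power[OF one, of "Suc k"] by simp
  moreover have nz: "\<beta> / (q\<^sup>2) ^ Suc k \<noteq> 0" using \<open>\<beta> \<noteq> 0\<close> q_nonzero by simp
  ultimately obtain i where i: "ladder i * F ^ Suc k \<notin> N"
      "q powi (2 * i) * (\<beta> / (q\<^sup>2) ^ Suc k) = \<beta>"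
    using ladder_reaches_generator[OF one assms(2) wt E_killed_xi[OF wt nz E]] by blast
  have "i \<le> 0"
  proof (rule ccontr)
    assume "\<not> i \<le> 0"
    then show False using ladder_pos[of i] i(1) mult_mem[OF E] by (simp add: mult.assoc)
  qed
  moreover have "q powi (2 * i) = q powi (2 * int (Suc k))"
    using i(2) \<open>\<beta> \<noteq> 0\<close> q_nonzero
    unfolding power_int_even by (simp add: field_simps)
  ultimately show False by (simp add: power_int_q_inj)
qed

lemma F_E_power_notin:
  assumes one: "of_weight N 1 \<beta>" and "E ^ Suc k \<notin> N"
  shows "F * E ^ Suc k \<notin> N"
proof
  assume F: "F * E ^ Suc k \<in> N"
  have "\<beta> \<noteq> 0" using weight_nonzero one one_notin by blast
  have wt: "of_weight N (E ^ Suc k) ((q\<^sup>2) ^ Suc k * \<beta>)"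
    using of_weight_E_power[OF one, of "Suc k"] by simp
  have "E * F * E ^ Suc k \<approx>\<^bsub>N\<^esub> coef 0 * E ^ Suc k"
    using mult_mem[OF F, of E] by (simp add: cong_0_iff mult.assoc)
  from ladder_reaches_generator[OF one assms(2) wt this]
  obtain i where i: "ladder i * E ^ Suc k \<notin> N" "q powi (2 * i) * ((q\<^sup>2) ^ Suc k * \<beta>) = \<beta>"
    by blast
  have "i \<ge> 0"
  proof (rule ccontr)
    assume "\<not> i \<ge> 0"
    then show False using ladder_neg[of i 1] i(1) mult_mem[OF F] by (simp add: mult.assoc)
  qed
  moreover have "q powi (2 * i) * q powi (2 * int (Suc k)) = 1"
    using i(2) \<open>\<beta> \<noteq> 0\<close> unfolding power_int_even by (simp flip: mult.assoc)
  then have "q powi (2 * i + 2 * int (Suc k)) = q powi 0"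
    using q_nonzero by (metis power_int_add power_int_0_right)
  ultimately show False unfolding power_int_q_inj by simp
qed

text \<open>
A nonzero \<open>F^(k+1) v\<close> is not killed by \<open>E\<close>, so it vanishes exactly when
\<open>E F^(k+1) v = (\<alpha> + f_down \<beta> k) F^k v\<close> does.
\<close>

lemma F_power_Suc_mem_iff:
  assumes "of_weight N 1 \<beta>" "E * F \<approx>\<^bsub>N\<^esub> coef \<alpha>" "F ^ k \<notin> N"
  shows "F ^ Suc k \<in> N \<longleftrightarrow> \<alpha> + f_down \<beta> k = 0"
proof -
  have "\<beta> \<noteq> 0" using weight_nonzero assms(1) one_notin by blast
  have "E * F ^ Suc k \<approx>\<^bsub>N\<^esub> F ^ k * (E * F + coef (f_down \<beta> k))"
    using E_F_ladder_cong[OF assms(1) \<open>\<beta> \<noteq> 0\<close>, of k] by simp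
  also have "\<dots> \<approx>\<^bsub>N\<^esub> F ^ k * (coef \<alpha> + coef (f_down \<beta> k))"
    using assms by (intro cong_mult cong_add cong_refl)
  also have "\<dots> = coef (\<alpha> + f_down \<beta> k) * F ^ k"
    by (simp add: coef_add [symmetric] coef_commute)
  finally have "E * F ^ Suc k \<in> N \<longleftrightarrow> coef (\<alpha> + f_down \<beta> k) * F ^ k \<in> N" by (rule cong_mem)
  also have "\<dots> \<longleftrightarrow> \<alpha> + f_down \<beta> k = 0"
    using assms(3) coef_mult_mem_iff[of "\<alpha> + f_down \<beta> k" "F ^ k"] by (auto simp: zero_mem)
  finally show ?thesis using E_F_power_notin[OF assms(1)] mult_mem by blast
qed

lemma E_power_Suc_mem_iff:
  assumes "of_weight N 1 \<beta>" "E * F \<approx>\<^bsub>N\<^esub> coef \<alpha>" "E ^ k \<notin> N"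
  shows "E ^ Suc k \<in> N \<longleftrightarrow> \<alpha> - f_up \<beta> (Suc k) = 0"
proof -
  have "\<beta> \<noteq> 0" using weight_nonzero assms(1) one_notin by blast
  have "F * E ^ Suc k \<approx>\<^bsub>N\<^esub> E ^ k * (E * F - coef (f_up \<beta> (Suc k)))"
    using F_E_ladder_cong[OF assms(1) \<open>\<beta> \<noteq> 0\<close>, of k] by simp
  also have "\<dots> \<approx>\<^bsub>N\<^esub> E ^ k * (coef \<alpha> - coef (f_up \<beta> (Suc k)))"
    using assms by (intro cong_mult cong_diff cong_refl)
  also have "\<dots> = coef (\<alpha> - f_up \<beta> (Suc k)) * E ^ k"
    by (simp add: coef_diff [symmetric] coef_commute)
  finally have "F * E ^ Suc k \<in> N \<longleftrightarrow> coef (\<alpha> - f_up \<beta> (Suc k)) * E ^ k \<in> N" by (rule cong_mem)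
  also have "\<dots> \<longleftrightarrow> \<alpha> - f_up \<beta> (Suc k) = 0"
    using assms(3) coef_mult_mem_iff[of "\<alpha> - f_up \<beta> (Suc k)" "E ^ k"] by (auto simp: zero_mem)
  finally show ?thesis using F_E_power_notin[OF assms(1)] mult_mem by blast
qed

text \<open>
Factor a root out of \<open>p\<close>: either the cofactor already kills \<open>v\<close>, and has smaller degree, or
it takes \<open>v\<close> to an eigenvector for that root.
\<close>

lemma xi_poly_eigenvector:
  assumes "xi_poly p \<in> N" "p \<noteq> 0"
  shows "\<exists>r \<alpha>. xi_poly r \<notin> N \<and> E * F * xi_poly r \<approx>\<^bsub>N\<^esub> coef \<alpha> * xi_poly r"
  using assms
proof (induction "degree p" arbitrary: p)
  case 0
  then obtain c where c: "p = [:c:]" by (metis degree_eq_zeroE)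
  then have "1 \<in> N" using 0 coef_mult_mem_iff[of c 1] by (simp add: xi_poly_const)
  then show ?case using one_notin by simp
next
  case (Suc d)
  then have "\<not> constant (poly p)" by (simp add: constant_degree)
  then obtain \<alpha> where "poly p \<alpha> = 0" using fundamental_theorem_of_algebra by blast
  then obtain r where r: "p = [:- \<alpha>, 1:] * r" by (metis dvdE poly_eq_0_iff_dvd)
  then have "r \<noteq> 0" using Suc.prems by auto
  then have "degree r = d"
    using r Suc.hyps(2) degree_mult_eq[of "[:- \<alpha>, 1:]" r] by (simp del: mult_pCons_left)
  have "p = pCons 0 r + smult (- \<alpha>) r" by (simp add: r)
  then have "xi_poly p = E * F * xi_poly r - coef \<alpha> * xi_poly r"
    by (simp only: xi_poly_add xi_poly_shift xi_poly_smult coef_minus) simp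
  then show ?case
    using Suc \<open>r \<noteq> 0\<close> \<open>degree r = d\<close> by (cases "xi_poly r \<in> N") (auto simp: cong_mod_def)
qed

text \<open>
If \<open>\<xi> v \<noteq> 0\<close>, then \<open>a \<xi> v = v\<close> for some \<open>a\<close>. By weight, only the degree zero part of
\<open>a\<close> matters, and this is a polynomial \<open>p\<close> in \<open>\<xi>\<close>. So \<open>1 - p(\<xi>) \<xi>\<close> kills \<open>v\<close>, and it
is a nonzero polynomial because its constant term is \<open>1\<close>.
\<close>

lemma xi_eigenvector:
  assumes one: "of_weight N 1 \<beta>"
  shows "\<exists>z \<alpha>. z \<notin> N \<and> of_weight N z \<beta> \<and> E * F * z \<approx>\<^bsub>N\<^esub> coef \<alpha> * z"
proof (cases "E * F \<in> N")
  case True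
  then show ?thesis
    using one one_notin by (intro exI[of _ 1] exI[of _ 0]) (simp add: cong_0_iff)
next
  case False
  have wt: "of_weight N (E * F) \<beta>" using of_weight_E_F[OF one] by simp
  have "\<beta> \<noteq> 0" using weight_nonzero one one_notin by blast
  obtain a where a: "a * (E * F) \<approx>\<^bsub>N\<^esub> 1" using maximal False by blast
  obtain I p where I: "finite I" "\<And>i. i \<notin> I \<Longrightarrow> p i = 0"
      "a * (E * F) \<approx>\<^bsub>N\<^esub> (\<Sum>i\<in>I. ladder i * (xi_poly (p i) * (E * F)))"
    using xi_span_UNIV[OF wt \<open>\<beta> \<noteq> 0\<close>, of a] unfolding xi_span_def by blast
  let ?w = "\<lambda>i. ladder i * (xi_poly (p i) * (E * F))"
  \<comment> \<open>The polynomial \<open>1 - X p 0\<close>, since right multiplication by \<open>\<xi>\<close> shifts the coefficients of \<open>p 0\<close>.\<close>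
  let ?r = "1 - pCons 0 (p 0)"
  have "1 \<approx>\<^bsub>N\<^esub> sum ?w I" using cong_trans[OF cong_sym[OF a] I(3)] .
  also have "sum ?w I = ?w 0 + sum ?w (I - {0})"
    using I(1,2) by (cases "0 \<in> I") (simp_all add: sum.remove)
  finally have "1 - ?w 0 \<approx>\<^bsub>N\<^esub> sum ?w (I - {0})" by (simp add: cong_mod_def algebra_simps)
  moreover have "xi_poly ?r = 1 - ?w 0"
  proof -
    have "?r = [:1:] + smult (- 1) (pCons 0 (p 0))" by (simp add: one_pCons)
    then have "xi_poly ?r = coef 1 + coef (- 1) * (xi_poly (p 0) * (E * F))"
      by (simp only: xi_poly_add xi_poly_const xi_poly_smult xi_poly_shift_right)
    then show ?thesis by (simp add: coef_minus ladder_def)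
  qed
  ultimately have "xi_poly ?r \<in> N"
    using I(1) wt \<open>\<beta> \<noteq> 0\<close> power_int_q_inj[of _ 0] of_weight_xi_poly[OF one, of ?r]
    by (intro weight_separation[of "I - {0}" _ \<beta> ?w "\<lambda>i. q powi (2 * i) * \<beta>"])
      (auto intro!: of_weight_ladder of_weight_xi_poly)
  moreover have "poly ?r 0 = 1" by simp
  then have "?r \<noteq> 0" by (metis poly_0 zero_neq_one)
  ultimately obtain r \<alpha> where "xi_poly r \<notin> N" "E * F * xi_poly r \<approx>\<^bsub>N\<^esub> coef \<alpha> * xi_poly r"
    using xi_poly_eigenvector by blast
  then show ?thesis using of_weight_xi_poly[OF one, of r] by auto
qed

lemma coef_cong_iff: "coef c \<approx>\<^bsub>N\<^esub> coef d \<longleftrightarrow> c = d"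
proof
  assume "coef c \<approx>\<^bsub>N\<^esub> coef d"
  then have "coef (c - d) * 1 \<in> N" by (simp add: cong_mod_def coef_diff)
  then show "c = d" using coef_mult_mem_iff[of "c - d" 1] one_notin by auto
qed simp

lemma eigenvalue_of_E_mem:
  assumes "of_weight N 1 \<beta>" "E * F \<approx>\<^bsub>N\<^esub> coef \<alpha>" "E \<in> N"
  shows "\<alpha> = f_val q m \<beta>"
proof -
  have "\<beta> \<noteq> 0" using weight_nonzero assms(1) one_notin by blast
  have "coef \<alpha> \<approx>\<^bsub>N\<^esub> E * F" by (rule cong_sym[OF assms(2)])
  also have "E * F \<approx>\<^bsub>N\<^esub> coef (f_val q m \<beta>)"
    using E_killed_xi[OF assms(1) \<open>\<beta> \<noteq> 0\<close>] assms(3) by simp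
  finally show ?thesis by (simp add: coef_cong_iff)
qed

lemma eigenvalue_of_F_mem:
  assumes "E * F \<approx>\<^bsub>N\<^esub> coef \<alpha>" "F \<in> N"
  shows "\<alpha> = 0"
proof -
  have "coef \<alpha> \<approx>\<^bsub>N\<^esub> E * F" by (rule cong_sym[OF assms(1)])
  also have "E * F \<approx>\<^bsub>N\<^esub> coef 0" using assms(2) by (simp add: cong_0_iff mult_mem)
  finally show ?thesis by (simp only: coef_cong_iff)
qed

lemma F_power_dichotomy:
  obtains (finite) n where "F ^ Suc n \<in> N" "\<And>k. k \<le> n \<Longrightarrow> F ^ k \<notin> N"
  | (infinite) "\<And>k. F ^ k \<notin> N"
proof (cases "\<forall>k. F ^ k \<notin> N")
  case False
  \<comment> \<open>The least vanishing power is not the zeroth, since the generator is nonzero.\<close>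
  define l where "l = (LEAST k. F ^ k \<in> N)"
  have l: "F ^ l \<in> N" "\<And>k. k < l \<Longrightarrow> F ^ k \<notin> N"
    using False unfolding l_def by (auto intro: LeastI dest: not_less_Least)
  then obtain n where "l = Suc n" using one_notin by (cases l) auto
  with l show thesis using finite by (simp add: less_Suc_eq_le)
qed (use infinite in blast)

text \<open>
The three alternatives are tried in this order. Hence in the second no nonzero weight vector is killed
by \<open>E\<close>, so the powers of \<open>E\<close> never reach zero, and in the third the same holds for \<open>F\<close>.
\<close>

lemma exists_extremal_or_free_eigenvector:
  assumes one: "of_weight N 1 \<beta>\<^sub>0"
  obtains z \<alpha> \<beta> where "z \<notin> N" "of_weight N z \<beta>" "E * F * z \<approx>\<^bsub>N\<^esub> coef \<alpha> * z"
    "E * z \<in> N \<or> F * z \<in> N \<and> (\<forall>k. E ^ k * z \<notin> N)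
      \<or> (\<forall>k. E ^ k * z \<notin> N) \<and> (\<forall>k. F ^ k * z \<notin> N)"
proof (cases "\<exists>z \<mu>. z \<notin> N \<and> of_weight N z \<mu> \<and> E * z \<in> N")
  case True
  then obtain z \<beta> where z: "z \<notin> N" "of_weight N z \<beta>" "E * z \<in> N" by blast
  show ?thesis
    by (rule that[OF z(1,2) E_killed_xi[OF z(2) weight_nonzero[OF z(2,1)] z(3)]]) (simp add: z)
next
  case noE: False
  have E_power: "E ^ k * z \<notin> N" if "z \<notin> N" "of_weight N z \<mu>" for z \<mu> k
  proof (induction k)
    case (Suc k)
    then show ?case
      using noE of_weight_E_power[OF that(2), of k] by (auto simp: mult.assoc)
  qed (use that in simp)
  show ?thesis
  proof (cases "\<exists>z \<mu>. z \<notin> N \<and> of_weight N z \<mu> \<and> F * z \<in> N")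
    case True
    then obtain z \<beta> where z: "z \<notin> N" "of_weight N z \<beta>" "F * z \<in> N" by blast
    have "E * F * z \<approx>\<^bsub>N\<^esub> coef 0 * z" using mult_mem[OF z(3)] by (simp add: cong_0_iff mult.assoc)
    then show ?thesis by (rule that[OF z(1,2)]) (use z E_power[OF z(1,2)] in blast)
  next
    case noF: False
    have F_power: "F ^ k * z \<notin> N" if "z \<notin> N" "of_weight N z \<mu>" for z \<mu> k
    proof (induction k)
      case (Suc k)
      then show ?case
        using noF of_weight_F_power[OF that(2), of k] by (auto simp: mult.assoc)
    qed (use that in simp)
    obtain z \<alpha> where z: "z \<notin> N" "of_weight N z \<beta>\<^sub>0" "E * F * z \<approx>\<^bsub>N\<^esub> coef \<alpha> * z"
      using xi_eigenvector[OF one] by blast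
    show ?thesis
      by (rule that[OF z]) (use E_power[OF z(1,2)] F_power[OF z(1,2)] in blast)
  qed
qed

end

section \<open>Closed forms of the structure constants\<close>

context generic_parameter
begin

lemma q_minus_inverse_nonzero: "q - inverse q \<noteq> 0"
proof
  assume "q - inverse q = 0"
  then have "q ^ 2 = 1" using q_nonzero by (simp add: field_simps power2_eq_square)
  then show False using q_not_root_of_unity[of 2] by simp
qed

lemma q_power_2m_neq_1: "n \<ge> 1 \<Longrightarrow> (q ^ (2 * m)) ^ n \<noteq> 1"
  using q_not_root_of_unity[of "2 * m * n"] m_pos by (simp add: power_mult [symmetric])

lemma f_val_up: "f_val q m ((q\<^sup>2) ^ i * \<beta>) =
    ((q ^ (2 * m)) ^ i * \<beta> ^ m - inverse (q ^ (2 * m)) ^ i * inverse \<beta> ^ m) / (q - inverse q)"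
  by (simp add: f_val_def power_mult_distrib power_inverse mult_ac flip: power_mult)

lemma f_val_down: "f_val q m (\<beta> / (q\<^sup>2) ^ i) =
    (inverse (q ^ (2 * m)) ^ i * \<beta> ^ m - (q ^ (2 * m)) ^ i * inverse \<beta> ^ m) / (q - inverse q)"
  by (simp add: f_val_def power_mult_distrib power_inverse divide_inverse mult_ac flip: power_mult)

lemma f_up_closed_form:
  defines "Q \<equiv> q ^ (2 * m)"
  shows "f_up \<beta> n = 1 / (q - inverse q) * ((1 - Q ^ n) / (1 - Q) * \<beta> ^ m
    - (1 - inverse Q ^ n) / (1 - inverse Q) * inverse \<beta> ^ m)"
proof -
  have "Q \<noteq> 1" "inverse Q \<noteq> 1" using q_power_2m_neq_1[of 1] by (auto simp: Q_def)
  then have "(\<Sum>i<n. Q ^ i) = (1 - Q ^ n) / (1 - Q)"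
    "(\<Sum>i<n. inverse Q ^ i) = (1 - inverse Q ^ n) / (1 - inverse Q)"
    by (simp_all add: sum_gp_strict)
  then show ?thesis
    unfolding f_up_def f_val_up Q_def [symmetric]
    by (simp add: sum_subtractf flip: sum_divide_distrib sum_distrib_right)
qed

lemma f_down_closed_form:
  defines "Q \<equiv> q ^ (2 * m)"
  shows "f_down \<beta> n = 1 / (q - inverse q) * (inverse Q * (1 - inverse Q ^ n) / (1 - inverse Q) * \<beta> ^ m
    - Q * (1 - Q ^ n) / (1 - Q) * inverse \<beta> ^ m)"
proof -
  have "Q \<noteq> 1" "inverse Q \<noteq> 1" using q_power_2m_neq_1[of 1] by (auto simp: Q_def)
  then have "(\<Sum>i<n. Q ^ Suc i) = Q * (1 - Q ^ n) / (1 - Q)"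
    "(\<Sum>i<n. inverse Q ^ Suc i) = inverse Q * (1 - inverse Q ^ n) / (1 - inverse Q)"
    by (simp_all add: sum_gp_strict flip: sum_distrib_left)
  then show ?thesis
    unfolding f_down_def f_val_down Q_def [symmetric]
    by (simp add: sum_subtractf del: power_Suc flip: sum_divide_distrib sum_distrib_right)
qed

text \<open>
With \<open>Q = q^(2m)\<close>, \<open>B = \<beta>^m\<close> and \<open>S = 1 + Q + ... + Q^n\<close>, the sum equals
\<open>S (B / Q^n - 1 / B) / (q - 1/q)\<close>, since reversing the geometric sum shows that the inverse powers of
\<open>Q\<close> add up to \<open>S / Q^n\<close>. As \<open>S \<noteq> 0\<close>, it vanishes if and only if \<open>B\<^sup>2 = Q^n\<close>.
\<close>

lemma f_val_add_f_down_eq_0_iff: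
  assumes "\<beta> \<noteq> 0"
  shows "f_val q m \<beta> + f_down \<beta> n = 0 \<longleftrightarrow> \<beta> ^ m = q ^ (m * n) \<or> \<beta> ^ m = - (q ^ (m * n))"
proof -
  define Q where "Q = q ^ (2 * m)"
  define B where "B = \<beta> ^ m"
  define S where "S = (\<Sum>i\<le>n. Q ^ i)"
  have nz: "Q \<noteq> 0" "B \<noteq> 0" using assms q_nonzero by (auto simp: Q_def B_def)
  have "(1 - Q) * S = 1 - Q ^ Suc n" unfolding S_def by (rule sum_gp_basic)
  then have "S \<noteq> 0" using q_power_2m_neq_1[of "Suc n"] by (auto simp: Q_def simp del: power_Suc)
  have rev: "(\<Sum>i\<le>n. inverse Q ^ i) = S / Q ^ n"
  proof -
    have "S = (\<Sum>i\<le>n. Q ^ (n - i))" unfolding S_def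
      by (rule sum.reindex_bij_witness[of _ "\<lambda>i. n - i" "\<lambda>i. n - i"]) auto
    also have "\<dots> = (\<Sum>i\<le>n. Q ^ n * inverse Q ^ i)"
      using nz by (intro sum.cong) (auto simp: power_diff field_simps)
    finally show ?thesis using nz by (simp flip: sum_distrib_left)
  qed
  have "f_val q m \<beta> + f_down \<beta> n = (\<Sum>i\<le>n. f_val q m (\<beta> / (q\<^sup>2) ^ i))"
    unfolding f_down_def by (induction n) (simp_all add: add.assoc [symmetric])
  also have "\<dots> = ((\<Sum>i\<le>n. inverse Q ^ i) * B - (\<Sum>i\<le>n. Q ^ i) * inverse B) / (q - inverse q)"
    unfolding f_val_down Q_def [symmetric] B_def
    by (simp add: sum_subtractf power_inverse flip: sum_divide_distrib sum_distrib_right)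
  also have "\<dots> = (S / Q ^ n * B - S * inverse B) / (q - inverse q)"
    by (simp only: rev S_def [symmetric])
  also have "\<dots> = S * (B\<^sup>2 - Q ^ n) / (Q ^ n * B * (q - inverse q))"
    using nz q_minus_inverse_nonzero by (simp add: field_simps power2_eq_square)
  finally have "f_val q m \<beta> + f_down \<beta> n = 0 \<longleftrightarrow> B\<^sup>2 = Q ^ n"
    using nz \<open>S \<noteq> 0\<close> q_minus_inverse_nonzero by simp
  also have "Q ^ n = (q ^ (m * n))\<^sup>2" by (simp add: Q_def mult_ac flip: power_mult)
  finally show ?thesis unfolding B_def by (simp add: power2_eq_iff)
qed

lemma f_val_eq_power_int:
  "f_val q m \<beta> = (\<beta> powi int m - \<beta> powi (- int m)) / (q - inverse q)"
  by (simp add: f_val_def power_int_minus power_inverse)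

lemma q_power_int_2m:
  "q powi (2 * int m) = q ^ (2 * m)" "q powi (- 2 * int m) = inverse (q ^ (2 * m))"
  "q powi (2 * int n * int m) = (q ^ (2 * m)) ^ n"
  "q powi (- 2 * int n * int m) = inverse (q ^ (2 * m)) ^ n"
proof -
  show 1: "q powi (2 * int m) = q ^ (2 * m)" by (simp add: power_int_even power_mult)
  have "2 * int n * int m = 2 * int (m * n)" by simp
  then show 2: "q powi (2 * int n * int m) = (q ^ (2 * m)) ^ n"
    by (simp only: power_int_even power_mult)
  show "q powi (- 2 * int m) = inverse (q ^ (2 * m))"
    using 1 power_int_minus[of q "2 * int m"] by simp
  show "q powi (- 2 * int n * int m) = inverse (q ^ (2 * m)) ^ n"
    using 2 power_int_minus[of q "2 * int n * int m"] by (simp add: power_inverse)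
qed

lemma f_up_eq_power_int:
  assumes "n \<ge> 0"
  shows "1 / (q - inverse q) *
      ((1 - q powi (2 * n * int m)) / (1 - q powi (2 * int m)) * \<beta> powi int m
       - (1 - q powi (- 2 * n * int m)) / (1 - q powi (- 2 * int m)) * \<beta> powi (- int m))
    = f_up \<beta> (nat n)"
proof -
  obtain k where k: "n = int k" using assms nonneg_int_cases by blast
  show ?thesis
    unfolding k q_power_int_2m f_up_closed_form by (simp add: power_int_minus power_inverse)
qed

lemma f_down_eq_power_int:
  assumes "n \<ge> 0"
  shows "1 / (q - inverse q) *
      (q powi (- 2 * int m) * (1 - q powi (- 2 * n * int m)) / (1 - q powi (- 2 * int m)) * \<beta> powi int m
       - q powi (2 * int m) * (1 - q powi (2 * n * int m)) / (1 - q powi (2 * int m)) * \<beta> powi (- int m))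
    = f_down \<beta> (nat n)"
proof -
  obtain k where k: "n = int k" using assms nonneg_int_cases by blast
  show ?thesis
    unfolding k q_power_int_2m f_down_closed_form by (simp add: power_int_minus power_inverse)
qed

end

section \<open>Left ideals and cyclic modules over a ring\<close>

definition left_ideal :: "('a, 'c) ring_scheme \<Rightarrow> 'a set \<Rightarrow> bool"
  where "left_ideal R L \<longleftrightarrow> additive_subgroup L R \<and> (\<forall>r\<in>carrier R. \<forall>x\<in>L. r \<otimes>\<^bsub>R\<^esub> x \<in> L)"

context ring
begin

lemma left_span_left_ideal:
  assumes S: "S \<subseteq> carrier R"
  shows "left_ideal R (left_span R S)"
proof -
  let ?G = "{r \<otimes> s | r s. r \<in> carrier R \<and> s \<in> S}"
  have G: "?G \<subseteq> carrier (add_monoid R)" using S by (auto simp: subset_iff)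
  have sub: "additive_subgroup (left_span R S) R"
    unfolding left_span_def by (intro additive_subgroup.intro add.generate_is_subgroup) (use G in simp)
  have "r \<otimes> x \<in> left_span R S" if r: "r \<in> carrier R" and x: "x \<in> left_span R S" for r x
  proof -
    from x have "x \<in> carrier R \<and> r \<otimes> x \<in> left_span R S" unfolding left_span_def
    proof (induction x rule: generate.induct)
      case one
      then show ?case using r generate.one[of "add_monoid R"] by simp
    next
      case (incl h)
      then obtain a s where "h = a \<otimes> s" "a \<in> carrier R" "s \<in> S" by blast
      moreover from this have "r \<otimes> h = (r \<otimes> a) \<otimes> s" using r S by (auto simp: m_assoc)
      ultimately show ?case using r S by (auto intro!: generate.incl)
    next
      case (inv h)
      then obtain a s where as: "h = a \<otimes> s" "a \<in> carrier R" "s \<in> S" by blast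
      then have "r \<otimes> (\<ominus> h) = \<ominus> ((r \<otimes> a) \<otimes> s)" using r S by (auto simp: m_assoc r_minus)
      moreover have "\<ominus> ((r \<otimes> a) \<otimes> s) \<in> generate (add_monoid R) ?G"
        unfolding a_inv_def using as r by (intro generate.inv) auto
      ultimately show ?case using as S by (auto simp: a_inv_def [symmetric])
    next
      case (eng x y)
      then show ?case using r generate.eng[of "r \<otimes> x" "add_monoid R" _ "r \<otimes> y"]
        by (simp add: r_distr)
    qed
    then show ?thesis by simp
  qed
  with sub show ?thesis by (simp add: left_ideal_def)
qed

lemma left_span_incl:
  assumes "S \<subseteq> carrier R"
  shows "S \<subseteq> left_span R S"
proof
  fix s assume "s \<in> S"
  then have "\<one> \<otimes> s \<in> left_span R S" unfolding left_span_def by (intro generate.incl) blast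
  then show "s \<in> left_span R S" using \<open>s \<in> S\<close> assms by auto
qed

lemma left_span_minimal:
  assumes "left_ideal R I" "S \<subseteq> I"
  shows "left_span R S \<subseteq> I"
proof -
  have "subgroup I (add_monoid R)"
    using assms by (simp add: left_ideal_def additive_subgroup.a_subgroup)
  moreover have "{r \<otimes> s | r s. r \<in> carrier R \<and> s \<in> S} \<subseteq> I"
    using assms by (auto simp: left_ideal_def)
  ultimately show ?thesis unfolding left_span_def by (rule add.generate_subgroup_incl [rotated])
qed

lemma left_ideal_add:
  assumes I: "left_ideal R I" and J: "left_ideal R J"
  shows "left_ideal R (I <+>\<^bsub>R\<^esub> J)"
proof -
  interpret I: additive_subgroup I R using I by (simp add: left_ideal_def)
  interpret J: additive_subgroup J R using J by (simp add: left_ideal_def)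
  have "r \<otimes> x \<in> I <+>\<^bsub>R\<^esub> J" if rx: "r \<in> carrier R" "x \<in> I <+>\<^bsub>R\<^esub> J" for r x
  proof -
    obtain a b where ab: "a \<in> I" "b \<in> J" "x = a \<oplus> b" using rx by (auto simp: set_add_def')
    then have "r \<otimes> x = r \<otimes> a \<oplus> r \<otimes> b" using rx by (simp add: r_distr)
    moreover have "r \<otimes> a \<in> I" "r \<otimes> b \<in> J" using ab rx I J by (simp_all add: left_ideal_def)
    ultimately show ?thesis by (auto simp: set_add_def')
  qed
  then show ?thesis
    using add_additive_subgroups[OF I.is_additive_subgroup J.is_additive_subgroup]
    by (simp add: left_ideal_def)
qed

lemma left_ideal_add_incl:
  assumes "left_ideal R I" "left_ideal R J"
  shows "I \<subseteq> I <+>\<^bsub>R\<^esub> J" "J \<subseteq> I <+>\<^bsub>R\<^esub> J"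
proof -
  interpret I: additive_subgroup I R using assms by (simp add: left_ideal_def)
  interpret J: additive_subgroup J R using assms by (simp add: left_ideal_def)
  show "I \<subseteq> I <+>\<^bsub>R\<^esub> J"
  proof
    fix x assume "x \<in> I"
    then have "x = x \<oplus> \<zero>" by simp
    with \<open>x \<in> I\<close> show "x \<in> I <+>\<^bsub>R\<^esub> J" unfolding set_add_def' using J.zero_closed by blast
  qed
  show "J \<subseteq> I <+>\<^bsub>R\<^esub> J"
  proof
    fix x assume "x \<in> J"
    then have "x = \<zero> \<oplus> x" by simp
    with \<open>x \<in> J\<close> show "x \<in> I <+>\<^bsub>R\<^esub> J" unfolding set_add_def' using I.zero_closed by blast
  qed
qed

lemma left_ideal_add_minimal:
  assumes "left_ideal R M" "I \<subseteq> M" "J \<subseteq> M"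
  shows "I <+>\<^bsub>R\<^esub> J \<subseteq> M"
proof -
  interpret M: additive_subgroup M R using assms by (simp add: left_ideal_def)
  show ?thesis using assms by (auto simp: set_add_def')
qed

end

context left_module
begin

lemma smult_l_null [simp]: "x \<in> carrier M \<Longrightarrow> \<zero>\<^bsub>R\<^esub> \<odot>\<^bsub>M\<^esub> x = \<zero>\<^bsub>M\<^esub>"
  using smult_l_distr[of "\<zero>\<^bsub>R\<^esub>" "\<zero>\<^bsub>R\<^esub>" x] smult_closed[of "\<zero>\<^bsub>R\<^esub>" x]
  by (simp add: M.add.l_cancel_one')

lemma smult_r_null [simp]: "a \<in> carrier R \<Longrightarrow> a \<odot>\<^bsub>M\<^esub> \<zero>\<^bsub>M\<^esub> = \<zero>\<^bsub>M\<^esub>"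
  using smult_r_distr[of a "\<zero>\<^bsub>M\<^esub>" "\<zero>\<^bsub>M\<^esub>"] smult_closed[of a "\<zero>\<^bsub>M\<^esub>"]
  by (simp add: M.add.l_cancel_one')

lemma smult_l_minus:
  assumes "a \<in> carrier R" "x \<in> carrier M"
  shows "(\<ominus>\<^bsub>R\<^esub> a) \<odot>\<^bsub>M\<^esub> x = \<ominus>\<^bsub>M\<^esub> (a \<odot>\<^bsub>M\<^esub> x)"
proof (rule M.minus_equality [symmetric])
  show "(\<ominus>\<^bsub>R\<^esub> a) \<odot>\<^bsub>M\<^esub> x \<oplus>\<^bsub>M\<^esub> a \<odot>\<^bsub>M\<^esub> x = \<zero>\<^bsub>M\<^esub>"
    using assms by (simp add: smult_l_distr [symmetric] R.l_neg)
qed (use assms smult_closed in auto)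

definition annihilator :: "'v \<Rightarrow> 'a set"
  where "annihilator v = {a \<in> carrier R. a \<odot>\<^bsub>M\<^esub> v = \<zero>\<^bsub>M\<^esub>}"

lemma minus_mem_annihilator_iff:
  assumes "a \<in> carrier R" "b \<in> carrier R" "v \<in> carrier M"
  shows "a \<ominus>\<^bsub>R\<^esub> b \<in> annihilator v \<longleftrightarrow> a \<odot>\<^bsub>M\<^esub> v = b \<odot>\<^bsub>M\<^esub> v"
proof -
  let ?x = "a \<odot>\<^bsub>M\<^esub> v" and ?y = "b \<odot>\<^bsub>M\<^esub> v"
  have xy: "?x \<in> carrier M" "?y \<in> carrier M" using assms smult_closed by auto
  have "a \<ominus>\<^bsub>R\<^esub> b \<in> annihilator v \<longleftrightarrow> ?x \<oplus>\<^bsub>M\<^esub> \<ominus>\<^bsub>M\<^esub> ?y = \<zero>\<^bsub>M\<^esub>"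
    using assms by (simp add: annihilator_def R.minus_eq smult_l_distr smult_l_minus)
  also have "\<dots> \<longleftrightarrow> ?x = ?y"
    using xy M.minus_equality[of ?x "\<ominus>\<^bsub>M\<^esub> ?y"] by (auto simp: M.r_neg)
  finally show ?thesis .
qed

lemma annihilator_left_ideal:
  assumes "v \<in> carrier M"
  shows "left_ideal R (annihilator v)"
  unfolding left_ideal_def
proof (intro conjI additive_subgroup.intro R.add.subgroupI ballI)
  fix a assume "a \<in> annihilator v"
  then show "\<ominus>\<^bsub>R\<^esub> a \<in> annihilator v"
    using assms by (simp add: annihilator_def smult_l_minus)
next
  fix r x assume "r \<in> carrier R" "x \<in> annihilator v"
  then show "r \<otimes>\<^bsub>R\<^esub> x \<in> annihilator v" using assms by (simp add: annihilator_def smult_assoc)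
qed (use assms in \<open>auto simp: annihilator_def smult_l_distr\<close>)

text \<open>
The isomorphism sends \<open>w\<close> to the set of all \<open>a\<close> with \<open>a v = w\<close>, which is a coset of the
annihilator.
\<close>

lemma quotient_by_annihilator_iso:
  assumes v: "v \<in> carrier M" and gen: "\<And>w. w \<in> carrier M \<Longrightarrow> \<exists>a\<in>carrier R. w = a \<odot>\<^bsub>M\<^esub> v"
  shows "module_iso R M (quot_module R (annihilator v))"
proof -
  let ?L = "annihilator v"
  have add: "additive_subgroup ?L R" using annihilator_left_ideal[OF v] by (simp add: left_ideal_def)
  interpret L: abelian_subgroup ?L R by (rule abelian_subgroupI3[OF add R.abelian_group_axioms])
  define h where "h w = {a \<in> carrier R. a \<odot>\<^bsub>M\<^esub> v = w}" for w
  have h: "h (a \<odot>\<^bsub>M\<^esub> v) = ?L +>\<^bsub>R\<^esub> a" if "a \<in> carrier R" for a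
  proof -
    have "x \<in> ?L +>\<^bsub>R\<^esub> a \<longleftrightarrow> x \<odot>\<^bsub>M\<^esub> v = a \<odot>\<^bsub>M\<^esub> v" if "x \<in> carrier R" for x
      using L.a_rcos_module_minus[OF R.ring_axioms \<open>a \<in> carrier R\<close> that]
        minus_mem_annihilator_iff[OF that \<open>a \<in> carrier R\<close> v] by simp
    moreover have "?L +>\<^bsub>R\<^esub> a \<subseteq> carrier R"
      using that by (intro R.a_r_coset_subset_G L.a_subset)
    ultimately show ?thesis unfolding h_def by auto
  qed
  show ?thesis unfolding module_iso_def
  proof (intro exI[of _ h] conjI ballI)
    show "bij_betw h (carrier M) (carrier (quot_module R ?L))"
    proof (rule bij_betw_imageI)
      show "inj_on h (carrier M)"
      proof (rule inj_onI)
        fix x y assume "x \<in> carrier M" "y \<in> carrier M" "h x = h y"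
        moreover from this gen obtain a where "a \<in> carrier R" "x = a \<odot>\<^bsub>M\<^esub> v" by blast
        ultimately show "x = y" unfolding h_def by blast
      qed
      show "h ` carrier M = carrier (quot_module R ?L)"
      proof (intro equalityI subsetI)
        fix A assume "A \<in> h ` carrier M"
        then obtain a where "a \<in> carrier R" "A = h (a \<odot>\<^bsub>M\<^esub> v)" using gen by blast
        then show "A \<in> carrier (quot_module R ?L)"
          using h R.a_rcosetsI[OF L.a_subset] by (simp add: quot_module_def)
      next
        fix A assume "A \<in> carrier (quot_module R ?L)"
        then obtain a where "a \<in> carrier R" "A = ?L +>\<^bsub>R\<^esub> a"
          by (auto simp: quot_module_def A_RCOSETS_def RCOSETS_def a_r_coset_def)
        then show "A \<in> h ` carrier M" using h[of a] v smult_closed by blast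
      qed
    qed
  next
    fix x y assume "x \<in> carrier M" "y \<in> carrier M"
    then obtain a b where ab: "a \<in> carrier R" "x = a \<odot>\<^bsub>M\<^esub> v" "b \<in> carrier R" "y = b \<odot>\<^bsub>M\<^esub> v"
      using gen by meson
    then have "x \<oplus>\<^bsub>M\<^esub> y = (a \<oplus>\<^bsub>R\<^esub> b) \<odot>\<^bsub>M\<^esub> v" using v by (simp add: smult_l_distr)
    then show "h (x \<oplus>\<^bsub>M\<^esub> y) = h x \<oplus>\<^bsub>quot_module R ?L\<^esub> h y"
      using ab h L.a_rcos_sum by (simp add: quot_module_def)
  next
    fix r x assume r: "r \<in> carrier R" and "x \<in> carrier M"
    then obtain a where a: "a \<in> carrier R" "x = a \<odot>\<^bsub>M\<^esub> v" using gen by blast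
    have "?L +>\<^bsub>R\<^esub> (r \<otimes>\<^bsub>R\<^esub> b) = h (r \<odot>\<^bsub>M\<^esub> x)" if "b \<in> h x" for b
      using that r v h[of "r \<otimes>\<^bsub>R\<^esub> b"] by (auto simp: h_def smult_assoc)
    moreover have "a \<in> h x" using a by (simp add: h_def)
    ultimately show "h (r \<odot>\<^bsub>M\<^esub> x) = r \<odot>\<^bsub>quot_module R ?L\<^esub> h x"
      by (auto simp: quot_module_def)
  qed
qed

lemma irreducible_generated_by_nonzero:
  assumes irr: "irreducible_module R M" and v: "v \<in> carrier M" "v \<noteq> \<zero>\<^bsub>M\<^esub>" and w: "w \<in> carrier M"
  shows "\<exists>a\<in>carrier R. w = a \<odot>\<^bsub>M\<^esub> v"
proof -
  let ?H = "(\<lambda>a. a \<odot>\<^bsub>M\<^esub> v) ` carrier R"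
  have "submodule ?H R M"
  proof (intro submodule.intro submodule_axioms.intro M.add.subgroupI)
    fix x assume "x \<in> ?H"
    then obtain a where "a \<in> carrier R" "x = a \<odot>\<^bsub>M\<^esub> v" by blast
    then show "\<ominus>\<^bsub>M\<^esub> x \<in> ?H"
      using v by (intro image_eqI[of _ _ "\<ominus>\<^bsub>R\<^esub> a"]) (auto simp: smult_l_minus)
  next
    fix x y assume "x \<in> ?H" "y \<in> ?H"
    then obtain a b where "a \<in> carrier R" "x = a \<odot>\<^bsub>M\<^esub> v" "b \<in> carrier R" "y = b \<odot>\<^bsub>M\<^esub> v" by blast
    then show "x \<oplus>\<^bsub>M\<^esub> y \<in> ?H"
      using v by (intro image_eqI[of _ _ "a \<oplus>\<^bsub>R\<^esub> b"]) (auto simp: smult_l_distr)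
  next
    fix r x assume "r \<in> carrier R" "x \<in> ?H"
    then show "r \<odot>\<^bsub>M\<^esub> x \<in> ?H"
      using v by (auto simp: smult_assoc [symmetric])
  qed (use v smult_closed in auto)
  moreover have "v \<in> ?H" using v by (intro image_eqI[of _ _ "\<one>\<^bsub>R\<^esub>"]) (auto simp: smult_one)
  ultimately have "?H = carrier M" using irr v unfolding irreducible_module_def by blast
  then show ?thesis using w by blast
qed

end

section \<open>The algebra \<open>U\<close> as a quotient of the free algebra\<close>

lemma ring_free_alg: "ring (ring_of_type_algebra :: free_alg ring)"
proof -
  have "\<exists>y. x + y = 0" for x :: free_alg
    using add.right_inverse by blast
  then show ?thesis
    unfolding ring_of_type_algebra_def
    by unfold_locales (auto simp: algebra_simps Units_def)
qed

lemma rel_ideal_ideal: "ideal (rel_ideal q m) ring_of_type_algebra"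
  unfolding rel_ideal_def
  by (rule ring.genideal_ideal[OF ring_free_alg]) (simp add: ring_of_type_algebra_def)

lemma relators_subset_rel_ideal: "relators q m \<subseteq> rel_ideal q m"
  unfolding rel_ideal_def
  by (rule ring.genideal_self[OF ring_free_alg]) (simp add: ring_of_type_algebra_def)

lemma Uq_ring: "ring (Uq q m)"
  unfolding Uq_def by (rule ideal.quotient_is_ring[OF rel_ideal_ideal])

lemma cls_hom: "cls q m \<in> ring_hom ring_of_type_algebra (Uq q m)"
  using ideal.rcos_ring_hom[OF rel_ideal_ideal] by (simp add: cls_def [abs_def] Uq_def)

lemma cls_closed [simp]: "cls q m x \<in> carrier (Uq q m)"
  and cls_add: "cls q m (x + y) = cls q m x \<oplus>\<^bsub>Uq q m\<^esub> cls q m y"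
  and cls_mult: "cls q m (x * y) = cls q m x \<otimes>\<^bsub>Uq q m\<^esub> cls q m y"
  and cls_1: "cls q m 1 = \<one>\<^bsub>Uq q m\<^esub>"
  using ring_hom_closed[OF cls_hom] ring_hom_add[OF cls_hom] ring_hom_mult[OF cls_hom]
    ring_hom_one[OF cls_hom]
  by (simp_all add: ring_of_type_algebra_def)

lemma cls_0: "cls q m 0 = \<zero>\<^bsub>Uq q m\<^esub>"
  using ring_hom_zero[OF cls_hom ring_free_alg Uq_ring] by (simp add: ring_of_type_algebra_def)

lemma cls_minus: "cls q m (- x) = \<ominus>\<^bsub>Uq q m\<^esub> cls q m x"
proof -
  interpret ring "Uq q m" by (rule Uq_ring)
  show ?thesis by (rule minus_equality [symmetric]) (simp_all flip: cls_add cls_0)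
qed

lemma cls_diff: "cls q m (x - y) = cls q m x \<ominus>\<^bsub>Uq q m\<^esub> cls q m y"
  using cls_add[of q m x "- y"] by (simp add: cls_minus a_minus_def)

lemma cls_power: "cls q m (x ^ n) = cls q m x [^]\<^bsub>Uq q m\<^esub> n"
proof -
  interpret ring "Uq q m" by (rule Uq_ring)
  show ?thesis by (induction n) (simp_all add: cls_1 cls_mult power_Suc2 del: power_Suc)
qed

lemma cls_relator: "r \<in> relators q m \<Longrightarrow> cls q m r = \<zero>\<^bsub>Uq q m\<^esub>"
proof -
  interpret ideal "rel_ideal q m" "ring_of_type_algebra :: free_alg ring" by (rule rel_ideal_ideal)
  assume "r \<in> relators q m"
  then have "cls q m r = rel_ideal q m"
    unfolding cls_def using relators_subset_rel_ideal by (intro a_rcos_const) blast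
  then show ?thesis by (simp add: Uq_def FactRing_def)
qed

lemma carrier_Uq: "carrier (Uq q m) = range (cls q m)"
  by (auto simp: Uq_def FactRing_def A_RCOSETS_def RCOSETS_def cls_def a_r_coset_def
      ring_of_type_algebra_def)

lemma (in generic_parameter) preimage_left_ideal:
  assumes "left_ideal (Uq q m) L"
  shows "U_left_ideal q m {x. cls q m x \<in> L}"
proof -
  interpret ring "Uq q m" by (rule Uq_ring)
  interpret L: additive_subgroup L "Uq q m" using assms by (simp add: left_ideal_def)
  show ?thesis
    using assms by unfold_locales
      (auto simp: cls_0 cls_add cls_mult cls_relator left_ideal_def)
qed

section \<open>Annihilators of vectors in modules over \<open>U\<close>\<close>

locale Uq_module = generic_parameter q m + left_module "Uq q m" V
  for q m and V :: "(free_alg set, 'v, 'd) module_scheme" (structure)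
begin

definition ann :: "'v \<Rightarrow> free_alg set"
  where "ann v = {x. cls q m x \<in> annihilator v}"

lemma mem_ann_iff: "x \<in> ann v \<longleftrightarrow> cls q m x \<odot>\<^bsub>V\<^esub> v = \<zero>\<^bsub>V\<^esub>"
  by (simp add: ann_def annihilator_def)

lemma ann_left_ideal: "v \<in> carrier V \<Longrightarrow> U_left_ideal q m (ann v)"
  unfolding ann_def by (intro preimage_left_ideal annihilator_left_ideal)

lemma cong_ann_iff:
  "v \<in> carrier V \<Longrightarrow> x \<approx>\<^bsub>ann v\<^esub> y \<longleftrightarrow> cls q m x \<odot>\<^bsub>V\<^esub> v = cls q m y \<odot>\<^bsub>V\<^esub> v"
  by (simp add: cong_mod_def ann_def cls_diff minus_mem_annihilator_iff)

lemma ann_maximal: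
  assumes irr: "irreducible_module (Uq q m) V" and v: "v \<in> carrier V" "v \<noteq> \<zero>\<^bsub>V\<^esub>"
  shows "maximal_U_left_ideal q m (ann v)"
proof -
  interpret A: U_left_ideal q m "ann v" by (rule ann_left_ideal[OF v(1)])
  show ?thesis
  proof
    show "1 \<notin> ann v" using v by (simp add: mem_ann_iff cls_1 smult_one)
  next
    fix x assume "x \<notin> ann v"
    then have "cls q m x \<odot>\<^bsub>V\<^esub> v \<noteq> \<zero>\<^bsub>V\<^esub>" by (simp add: mem_ann_iff)
    then obtain a where "v = cls q m a \<odot>\<^bsub>V\<^esub> (cls q m x \<odot>\<^bsub>V\<^esub> v)"
      using irreducible_generated_by_nonzero[OF irr _ _ v(1)] v smult_closed
      unfolding carrier_Uq by fastforce
    then show "\<exists>a. a * x \<approx>\<^bsub>ann v\<^esub> 1"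
      using v by (intro exI[of _ a]) (simp add: cong_ann_iff cls_mult cls_1 smult_assoc smult_one)
  qed
qed

lemma cong_ann_smult_iff:
  "v \<in> carrier V \<Longrightarrow> x \<approx>\<^bsub>ann (cls q m z \<odot>\<^bsub>V\<^esub> v)\<^esub> y \<longleftrightarrow> x * z \<approx>\<^bsub>ann v\<^esub> y * z"
  by (simp add: cong_ann_iff smult_closed cls_mult smult_assoc)

text \<open>
Passing from \<open>v\<close> to another vector \<open>z v\<close> of the same module amounts to right multiplication by
\<open>z\<close> in the free algebra.
\<close>

lemma mem_ann_smult_iff:
  "v \<in> carrier V \<Longrightarrow> x \<in> ann (cls q m z \<odot>\<^bsub>V\<^esub> v) \<longleftrightarrow> x * z \<in> ann v"
  by (simp add: mem_ann_iff cls_mult smult_assoc)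

lemma exists_weight_vector:
  assumes "is_direct_sum V (weight_space q m V)" "carrier V \<noteq> {\<zero>\<^bsub>V\<^esub>}"
  shows "\<exists>v \<mu>. v \<in> carrier V \<and> v \<noteq> \<zero>\<^bsub>V\<^esub> \<and> of_weight (ann v) 1 \<mu>"
proof -
  obtain v where v: "v \<in> carrier V" "v \<noteq> \<zero>\<^bsub>V\<^esub>" using assms(2) by auto
  then obtain w where w: "\<And>\<mu>. w \<mu> \<in> weight_space q m V \<mu>"
      "v = (\<Oplus>\<^bsub>V\<^esub>\<mu>\<in>{\<mu>. w \<mu> \<noteq> \<zero>\<^bsub>V\<^esub>}. w \<mu>)"
    using assms(1) unfolding is_direct_sum_def by blast
  have "{\<mu>. w \<mu> \<noteq> \<zero>\<^bsub>V\<^esub>} \<noteq> {}"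
  proof
    assume *: "{\<mu>. w \<mu> \<noteq> \<zero>\<^bsub>V\<^esub>} = {}"
    show False using w(2) v(2) unfolding * by simp
  qed
  then obtain \<mu> where "w \<mu> \<noteq> \<zero>\<^bsub>V\<^esub>" by blast
  moreover have "w \<mu> \<in> carrier V" "of_weight (ann (w \<mu>)) 1 \<mu>"
    using w(1)[of \<mu>] by (auto simp: weight_space_def of_weight_def cong_ann_iff uK_def scal_def)
  ultimately show ?thesis by blast
qed

text \<open>
\<open>\<xi>\<close>, \<open>K\<close> and its inverse have \<open>v\<close> as a common eigenvector, and the elements that act on
\<open>v\<close> by a scalar form a subring.
\<close>

lemma R_acts_by_scalars:
  assumes v: "v \<in> carrier V" and wt: "of_weight (ann v) 1 \<beta>" "\<beta> \<noteq> 0"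
    and xi: "E * F \<approx>\<^bsub>ann v\<^esub> coef \<alpha>"
    and r: "r \<in> carrier (R_ring q m)"
  shows "\<exists>x c. r = cls q m x \<and> x \<approx>\<^bsub>ann v\<^esub> coef c"
proof -
  interpret A: U_left_ideal q m "ann v" by (rule ann_left_ideal[OF v])
  from r have "r \<in> generate_ring (Uq q m) (range (scal q m) \<union> {xi q m, uK q m, uKinv q m})"
    by (simp add: R_ring_def)
  then show ?thesis
  proof (induction r rule: generate_ring.induct)
    case one
    then show ?case by (intro exI[of _ 1]) (simp add: cls_1)
  next
    case (incl h)
    have "K \<approx>\<^bsub>ann v\<^esub> coef \<beta>" "Kinv \<approx>\<^bsub>ann v\<^esub> coef (inverse \<beta>)"
      using wt A.Kinv_cong[OF wt] by (simp_all add: of_weight_def)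
    then have scalar: "\<exists>c. x \<approx>\<^bsub>ann v\<^esub> coef c" if "x \<in> range coef \<union> {E * F, K, Kinv}" for x
      using that xi A.cong_refl by blast
    have "h \<in> cls q m ` (range coef \<union> {E * F, K, Kinv})"
      using incl by (auto simp: scal_def xi_def uE_def uF_def uK_def uKinv_def cls_mult image_Un)
    with scalar show ?case by blast
  next
    case (a_inv h)
    then obtain x c where "h = cls q m x" "x \<approx>\<^bsub>ann v\<^esub> coef c" by blast
    then show ?case
      using A.minus_mem[of "x - coef c"]
      by (intro exI[of _ "- x"] exI[of _ "- c"]) (simp add: cls_minus coef_minus cong_mod_def)
  next
    case (eng_add h k)
    then obtain x c y d where "h = cls q m x" "x \<approx>\<^bsub>ann v\<^esub> coef c" "k = cls q m y" "y \<approx>\<^bsub>ann v\<^esub> coef d"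
      by blast
    then show ?case
      using A.cong_add[of x "coef c" y "coef d"]
      by (intro exI[of _ "x + y"] exI[of _ "c + d"]) (simp add: cls_add coef_add)
  next
    case (eng_mult h k)
    then obtain x c y d where h: "h = cls q m x" "x \<approx>\<^bsub>ann v\<^esub> coef c"
      and k: "k = cls q m y" "y \<approx>\<^bsub>ann v\<^esub> coef d" by blast
    have "x * y \<approx>\<^bsub>ann v\<^esub> x * coef d" by (rule A.cong_mult[OF k(2)])
    also have "x * coef d = coef d * x" by (rule coef_commute [symmetric])
    also have "\<dots> \<approx>\<^bsub>ann v\<^esub> coef d * coef c" by (rule A.cong_mult[OF h(2)])
    finally have "x * y \<approx>\<^bsub>ann v\<^esub> coef (d * c)" by (simp add: coef_mult)
    then show ?case using h k
      by (intro exI[of _ "x * y"] exI[of _ "d * c"]) (simp add: cls_mult)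
  qed
qed

lemma R_subring: "subring (carrier (R_ring q m)) (Uq q m)"
  unfolding R_ring_def
  by (simp, intro R.generate_ring_is_subring)
    (auto simp: scal_def xi_def uE_def uF_def uK_def uKinv_def)

lemma R_ring_ring: "ring (R_ring q m)"
  using R.subring_is_ring[OF R_subring] by (simp add: R_ring_def)

lemma P_gens_in_R:
  "{xi q m \<ominus>\<^bsub>Uq q m\<^esub> scal q m \<alpha>, uK q m \<ominus>\<^bsub>Uq q m\<^esub> scal q m \<beta>} \<subseteq> carrier (R_ring q m)"
proof -
  have "{xi q m, uK q m, scal q m \<alpha>, scal q m \<beta>} \<subseteq> carrier (R_ring q m)"
    by (auto simp: R_ring_def intro: generate_ring.incl)
  then show ?thesis
    using subringE(5,7)[OF R_subring] by (auto simp: a_minus_def)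
qed

lemma P_gens_subset_P: 
  "{xi q m \<ominus>\<^bsub>Uq q m\<^esub> scal q m \<alpha>, uK q m \<ominus>\<^bsub>Uq q m\<^esub> scal q m \<beta>} \<subseteq> P_ideal q m \<alpha> \<beta>"
  unfolding P_ideal_def by (rule ring.genideal_self[OF R_ring_ring P_gens_in_R])

lemma P_ideal_subset_carrier: "P_ideal q m \<alpha> \<beta> \<subseteq> carrier (Uq q m)"
proof -
  have "P_ideal q m \<alpha> \<beta> \<subseteq> carrier (R_ring q m)"
    unfolding P_ideal_def
    by (rule ring.genideal_minimal[OF R_ring_ring ring.oneideal[OF R_ring_ring] P_gens_in_R])
  then show ?thesis using subringE(1)[OF R_subring] by blast
qed

text \<open>
\<open>P\<close> is a two-sided ideal of \<open>R\<close>, while annihilators are only left ideals of \<open>U\<close>. Inside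
\<open>R\<close> the annihilator of \<open>v\<close> is also closed under right multiplication, because \<open>R\<close> acts on
\<open>v\<close> by scalars.
\<close>

lemma P_ideal_subset_annihilator:
  assumes v: "v \<in> carrier V" and wt: "of_weight (ann v) 1 \<beta>" "\<beta> \<noteq> 0"
    and xi: "E * F \<approx>\<^bsub>ann v\<^esub> coef \<alpha>"
  shows "P_ideal q m \<alpha> \<beta> \<subseteq> annihilator v"
proof -
  interpret A: U_left_ideal q m "ann v" by (rule ann_left_ideal[OF v])
  let ?I = "carrier (R_ring q m) \<inter> annihilator v"
  have ops: "(\<oplus>\<^bsub>R_ring q m\<^esub>) = (\<oplus>\<^bsub>Uq q m\<^esub>)" "(\<otimes>\<^bsub>R_ring q m\<^esub>) = (\<otimes>\<^bsub>Uq q m\<^esub>)"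
    "\<zero>\<^bsub>R_ring q m\<^esub> = \<zero>\<^bsub>Uq q m\<^esub>"
    by (simp_all add: R_ring_def)
  have left: "left_ideal (Uq q m) (annihilator v)" by (rule annihilator_left_ideal[OF v])
  then interpret B: additive_subgroup "annihilator v" "Uq q m" by (simp add: left_ideal_def)
  interpret RR: ring "R_ring q m" by (rule R_ring_ring)
  have "ideal ?I (R_ring q m)"
  proof (rule idealI[OF R_ring_ring])
    show "subgroup ?I (add_monoid (R_ring q m))"
    proof (rule RR.add.subgroupI)
      fix a assume a: "a \<in> ?I"
      have "\<ominus>\<^bsub>R_ring q m\<^esub> a = \<ominus>\<^bsub>Uq q m\<^esub> a"
        using a subringE(1,5)[OF R_subring] by (intro RR.minus_equality) (auto simp: ops R.l_neg)
      then show "\<ominus>\<^bsub>R_ring q m\<^esub> a \<in> ?I"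
        using a subringE(5)[OF R_subring] by simp
    next
      have "\<zero>\<^bsub>Uq q m\<^esub> \<in> ?I" using RR.zero_closed unfolding ops by simp
      then show "?I \<noteq> {}" by blast
    qed (use RR.a_closed in \<open>auto simp: ops\<close>)
  next
    fix a r assume a: "a \<in> ?I" and r: "r \<in> carrier (R_ring q m)"
    have rU: "r \<in> carrier (Uq q m)" using r subringE(1)[OF R_subring] by blast
    then show "r \<otimes>\<^bsub>R_ring q m\<^esub> a \<in> ?I"
      using a r RR.m_closed[OF r, of a] left by (auto simp: ops left_ideal_def)
    obtain x c where x: "r = cls q m x" "x \<approx>\<^bsub>ann v\<^esub> coef c"
      using R_acts_by_scalars[OF v wt xi r] by blast
    obtain y where y: "a = cls q m y"
      using a unfolding annihilator_def carrier_Uq by blast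
    then have "y \<in> ann v" using a by (simp add: ann_def)
    have "y * x \<approx>\<^bsub>ann v\<^esub> y * coef c" by (rule A.cong_mult[OF x(2)])
    also have "y * coef c = coef c * y" by (rule coef_commute [symmetric])
    finally have "y * x \<in> ann v" using A.cong_mem A.mult_mem[OF \<open>y \<in> ann v\<close>] by blast
    then show "a \<otimes>\<^bsub>R_ring q m\<^esub> r \<in> ?I"
      using a r x y RR.m_closed[of a r] by (simp add: ann_def cls_mult ops)
  qed
  moreover have gens: "{xi q m \<ominus>\<^bsub>Uq q m\<^esub> scal q m \<alpha>, uK q m \<ominus>\<^bsub>Uq q m\<^esub> scal q m \<beta>} \<subseteq> annihilator v"
    using wt xi
    by (simp add: xi_def uK_def uE_def uF_def scal_def ann_def of_weight_def cong_mod_def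
        flip: cls_mult cls_diff)
  ultimately have "P_ideal q m \<alpha> \<beta> \<subseteq> ?I"
    unfolding P_ideal_def by (rule RR.genideal_minimal[OF _ Int_greatest[OF P_gens_in_R]])
  then show ?thesis by blast
qed

end

section \<open>The module generated by a common eigenvector\<close>

locale eigenvector = Uq_module q m V
  for q m and V :: "(free_alg set, 'v, 'd) module_scheme" (structure) +
  fixes v :: 'v and \<alpha> \<beta> :: complex
  assumes irreducible: "irreducible_module (Uq q m) V"
    and v_closed: "v \<in> carrier V" and v_nonzero: "v \<noteq> \<zero>\<^bsub>V\<^esub>"
    and weight: "of_weight (ann v) 1 \<beta>"
    and xi: "E * F \<approx>\<^bsub>ann v\<^esub> coef \<alpha>"

sublocale eigenvector \<subseteq> N: maximal_U_left_ideal q m "ann v"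
  by (rule ann_maximal[OF irreducible v_closed v_nonzero])

context eigenvector
begin

lemma beta_nonzero: "\<beta> \<noteq> 0"
  using N.weight_nonzero[OF weight N.one_notin] .

text \<open>
The comparison of left ideals, carried back to \<open>U\<close>: here \<open>L\<close> is the left ideal prescribed by
one of the four cases, and it has to be shown equal to the full annihilator of \<open>v\<close>.
\<close>

lemma iso_quotient_by_left_ideal:
  assumes L: "left_ideal (Uq q m) L" "P_ideal q m \<alpha> \<beta> \<subseteq> L" "L \<subseteq> annihilator v"
    and lad: "\<And>i. cls q m (ladder i) \<in> L \<or> ladder i \<notin> ann v"
  shows "module_iso (Uq q m) V (quot_module (Uq q m) L)"
proof -
  have "{x. cls q m x \<in> L} = ann v"
  proof (rule N.eq_of_ladder[OF preimage_left_ideal[OF L(1)] _ _ _ beta_nonzero])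
    show "{x. cls q m x \<in> L} \<subseteq> ann v" using L(3) by (auto simp: ann_def)
    show "K - coef \<beta> \<in> {x. cls q m x \<in> L}" "E * F - coef \<alpha> \<in> {x. cls q m x \<in> L}"
      using P_gens_subset_P[of \<alpha> \<beta>] L(2)
      by (auto simp: xi_def uK_def uE_def uF_def scal_def cls_mult cls_diff)
  qed (use lad in simp)
  then have "L = annihilator v"
    using L unfolding left_ideal_def ann_def annihilator_def carrier_Uq by blast
  then show ?thesis
    using quotient_by_annihilator_iso[OF v_closed]
      irreducible_generated_by_nonzero[OF irreducible v_closed v_nonzero] by blast
qed

lemma left_span_P_ideal:
  "left_ideal (Uq q m) (left_span (Uq q m) (P_ideal q m \<alpha> \<beta>))"
  "P_ideal q m \<alpha> \<beta> \<subseteq> left_span (Uq q m) (P_ideal q m \<alpha> \<beta>)"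
  "left_span (Uq q m) (P_ideal q m \<alpha> \<beta>) \<subseteq> annihilator v"
  by (rule R.left_span_left_ideal[OF P_ideal_subset_carrier] R.left_span_incl[OF P_ideal_subset_carrier]
      R.left_span_minimal[OF annihilator_left_ideal[OF v_closed]
        P_ideal_subset_annihilator[OF v_closed weight beta_nonzero xi]])+

lemma left_span_singleton:
  "left_ideal (Uq q m) (left_span (Uq q m) {cls q m x})"
  "cls q m (a * x) \<in> left_span (Uq q m) {cls q m x}"
  "x \<in> ann v \<Longrightarrow> left_span (Uq q m) {cls q m x} \<subseteq> annihilator v"
  using R.left_span_left_ideal[of "{cls q m x}"] R.left_span_incl[of "{cls q m x}"]
    R.left_span_minimal[OF annihilator_left_ideal[OF v_closed], of "{cls q m x}"]
  by (auto simp: ann_def cls_mult left_ideal_def)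

text \<open>
Three forms of the comparison, according to the number of generators that the annihilator needs
beyond those of \<open>P\<close>. Every vanishing rung has to be a left multiple of one of these generators.
\<close>

lemma iso_no_vanishing:
  assumes E: "\<And>k. E ^ k \<notin> ann v" and F: "\<And>k. F ^ k \<notin> ann v"
  shows "module_iso (Uq q m) V (quot_module (Uq q m) (left_span (Uq q m) (P_ideal q m \<alpha> \<beta>)))"
  by (rule iso_quotient_by_left_ideal[OF left_span_P_ideal]) (simp add: ladder_def E F)

lemma iso_one_vanishing:
  assumes x: "x \<in> ann v" and lad: "\<And>i. (\<exists>a. ladder i = a * x) \<or> ladder i \<notin> ann v"
  shows "module_iso (Uq q m) V (quot_module (Uq q m)
    (left_span (Uq q m) (P_ideal q m \<alpha> \<beta>) <+>\<^bsub>Uq q m\<^esub> left_span (Uq q m) {cls q m x}))"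
    (is "module_iso _ _ (quot_module _ (?P <+>\<^bsub>_\<^esub> ?X))")
proof (rule iso_quotient_by_left_ideal)
  note incl = R.left_ideal_add_incl[OF left_span_P_ideal(1) left_span_singleton(1)[of x]]
  show "left_ideal (Uq q m) (?P <+>\<^bsub>Uq q m\<^esub> ?X)"
    by (rule R.left_ideal_add[OF left_span_P_ideal(1) left_span_singleton(1)])
  show "P_ideal q m \<alpha> \<beta> \<subseteq> ?P <+>\<^bsub>Uq q m\<^esub> ?X" using left_span_P_ideal(2) incl(1) by blast
  show "?P <+>\<^bsub>Uq q m\<^esub> ?X \<subseteq> annihilator v"
    by (rule R.left_ideal_add_minimal[OF annihilator_left_ideal[OF v_closed] left_span_P_ideal(3)
          left_span_singleton(3)[OF x]])
  show "cls q m (ladder i) \<in> ?P <+>\<^bsub>Uq q m\<^esub> ?X \<or> ladder i \<notin> ann v" for i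
    using lad[of i] subsetD[OF incl(2) left_span_singleton(2)] by metis
qed

lemma iso_two_vanishing:
  assumes x: "x \<in> ann v" and y: "y \<in> ann v"
    and lad: "\<And>i. (\<exists>a. ladder i = a * x) \<or> (\<exists>a. ladder i = a * y) \<or> ladder i \<notin> ann v"
  shows "module_iso (Uq q m) V (quot_module (Uq q m)
    (left_span (Uq q m) (P_ideal q m \<alpha> \<beta>) <+>\<^bsub>Uq q m\<^esub> left_span (Uq q m) {cls q m x}
      <+>\<^bsub>Uq q m\<^esub> left_span (Uq q m) {cls q m y}))"
    (is "module_iso _ _ (quot_module _ (?P <+>\<^bsub>_\<^esub> ?X <+>\<^bsub>_\<^esub> ?Y))")
proof (rule iso_quotient_by_left_ideal)
  note ann = annihilator_left_ideal[OF v_closed]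
  note PX = R.left_ideal_add[OF left_span_P_ideal(1) left_span_singleton(1)[of x]]
  note incl = R.left_ideal_add_incl[OF left_span_P_ideal(1) left_span_singleton(1)[of x]]
    R.left_ideal_add_incl[OF PX left_span_singleton(1)[of y]]
  show "left_ideal (Uq q m) (?P <+>\<^bsub>Uq q m\<^esub> ?X <+>\<^bsub>Uq q m\<^esub> ?Y)"
    by (rule R.left_ideal_add[OF PX left_span_singleton(1)])
  show "P_ideal q m \<alpha> \<beta> \<subseteq> ?P <+>\<^bsub>Uq q m\<^esub> ?X <+>\<^bsub>Uq q m\<^esub> ?Y"
    using left_span_P_ideal(2) incl by blast
  show "?P <+>\<^bsub>Uq q m\<^esub> ?X <+>\<^bsub>Uq q m\<^esub> ?Y \<subseteq> annihilator v"
    by (rule R.left_ideal_add_minimal[OF ann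
          R.left_ideal_add_minimal[OF ann left_span_P_ideal(3) left_span_singleton(3)[OF x]]
          left_span_singleton(3)[OF y]])
  show "cls q m (ladder i) \<in> ?P <+>\<^bsub>Uq q m\<^esub> ?X <+>\<^bsub>Uq q m\<^esub> ?Y \<or> ladder i \<notin> ann v" for i
    using lad[of i] subsetD[OF incl(3) subsetD[OF incl(2) left_span_singleton(2)]]
      subsetD[OF incl(4) left_span_singleton(2)] by metis
qed

end

section \<open>The classification\<close>

text \<open>
A vector \<open>z v\<^sub>0\<close> of the module is chosen to be killed by \<open>E\<close> if possible, otherwise by \<open>F\<close> if
possible, and otherwise to be any common eigenvector. The first choice splits according to whether a
power of \<open>F\<close> kills the vector.
\<close>

theorem corollary2p2:
  fixes q :: complex and m :: nat and V :: "(free_alg set, 'v) module"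
  assumes q_nonzero: "q \<noteq> 0"
    and q_not_root_of_unity: "\<forall>k::nat. k \<ge> 1 \<longrightarrow> q ^ k \<noteq> 1"
    and m_pos: "m \<ge> 1"
    and weight: "weight_rep q m V"
    and irreducible: "irreducible_module (Uq q m) V"
  shows "\<exists>\<alpha> \<beta> :: complex. \<beta> \<noteq> 0 \<and>
    ((\<exists>n::nat.
        \<alpha> = (\<beta> powi int m - \<beta> powi (- int m)) / (q - inverse q) \<and>
        (\<beta> ^ m = q ^ (m * n) \<or> \<beta> ^ m = - (q ^ (m * n))) \<and>
        module_iso (Uq q m) V
          (quot_module (Uq q m)
            (left_span (Uq q m) (P_ideal q m \<alpha> \<beta>)
              <+>\<^bsub>Uq q m\<^esub> left_span (Uq q m) {uE q m}
              <+>\<^bsub>Uq q m\<^esub> left_span (Uq q m) {uF q m [^]\<^bsub>Uq q m\<^esub> (n + 1)})))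
    \<or> (\<alpha> = (\<beta> powi int m - \<beta> powi (- int m)) / (q - inverse q) \<and>
        (\<forall>n::nat. \<beta> ^ m \<noteq> q ^ (m * n) \<and> \<beta> ^ m \<noteq> - (q ^ (m * n))) \<and>
        module_iso (Uq q m) V
          (quot_module (Uq q m)
            (left_span (Uq q m) (P_ideal q m \<alpha> \<beta>)
              <+>\<^bsub>Uq q m\<^esub> left_span (Uq q m) {uE q m})))
    \<or> (\<alpha> = 0 \<and>
        (\<forall>n::int. n \<ge> 1 \<longrightarrow>
          1 / (q - inverse q) *
            ((1 - q powi (2 * n * int m)) / (1 - q powi (2 * int m)) * \<beta> powi int m
             - (1 - q powi (- 2 * n * int m)) / (1 - q powi (- 2 * int m)) * \<beta> powi (- int m)) \<noteq> 0) \<and>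
        module_iso (Uq q m) V
          (quot_module (Uq q m)
            (left_span (Uq q m) (P_ideal q m \<alpha> \<beta>)
              <+>\<^bsub>Uq q m\<^esub> left_span (Uq q m) {uF q m})))
    \<or> ((\<forall>n::int. n \<ge> 0 \<longrightarrow>
          \<alpha> \<noteq> - (1 / (q - inverse q) *
            (q powi (- 2 * int m) * (1 - q powi (- 2 * n * int m)) / (1 - q powi (- 2 * int m)) * \<beta> powi int m
             - q powi (2 * int m) * (1 - q powi (2 * n * int m)) / (1 - q powi (2 * int m)) * \<beta> powi (- int m)))) \<and>
        (\<forall>n::int. n \<ge> 1 \<longrightarrow>
          \<alpha> \<noteq> 1 / (q - inverse q) *
            ((1 - q powi (2 * n * int m)) / (1 - q powi (2 * int m)) * \<beta> powi int m
             - (1 - q powi (- 2 * n * int m)) / (1 - q powi (- 2 * int m)) * \<beta> powi (- int m))) \<and>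
        module_iso (Uq q m) V
          (quot_module (Uq q m) (left_span (Uq q m) (P_ideal q m \<alpha> \<beta>)))))"
proof -
  interpret left_module "Uq q m" V using weight by (simp add: weight_rep_def)
  interpret Uq_module q m V
    by unfold_locales (use q_nonzero q_not_root_of_unity m_pos in auto)
  have "is_direct_sum V (weight_space q m V)" "carrier V \<noteq> {\<zero>\<^bsub>V\<^esub>}"
    using weight irreducible by (simp_all add: weight_rep_def irreducible_module_def)
  then obtain v\<^sub>0 \<beta>\<^sub>0 where v\<^sub>0: "v\<^sub>0 \<in> carrier V" "v\<^sub>0 \<noteq> \<zero>\<^bsub>V\<^esub>" "of_weight (ann v\<^sub>0) 1 \<beta>\<^sub>0"
    using exists_weight_vector by blast
  interpret N\<^sub>0: maximal_U_left_ideal q m "ann v\<^sub>0"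
    by (rule ann_maximal[OF irreducible v\<^sub>0(1,2)])
  obtain z \<alpha> \<beta> where z: "z \<notin> ann v\<^sub>0" "of_weight (ann v\<^sub>0) z \<beta>"
      "E * F * z \<approx>\<^bsub>ann v\<^sub>0\<^esub> coef \<alpha> * z"
    and extremal: "E * z \<in> ann v\<^sub>0 \<or> F * z \<in> ann v\<^sub>0 \<and> (\<forall>k. E ^ k * z \<notin> ann v\<^sub>0)
      \<or> (\<forall>k. E ^ k * z \<notin> ann v\<^sub>0) \<and> (\<forall>k. F ^ k * z \<notin> ann v\<^sub>0)"
    by (rule N\<^sub>0.exists_extremal_or_free_eigenvector[OF v\<^sub>0(3)])
  define v where "v = cls q m z \<odot>\<^bsub>V\<^esub> v\<^sub>0"
  have mem: "x \<in> ann v \<longleftrightarrow> x * z \<in> ann v\<^sub>0" for x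
    unfolding v_def by (rule mem_ann_smult_iff[OF v\<^sub>0(1)])
  interpret eigenvector q m V v \<alpha> \<beta>
    using v\<^sub>0(1) z irreducible smult_closed
    by unfold_locales
      (auto simp: v_def mem_ann_iff of_weight_def cong_ann_smult_iff mult.assoc)
  consider (highest) "E \<in> ann v"
    | (lowest) "F \<in> ann v" "\<And>k. E ^ k \<notin> ann v"
    | (free) "\<And>k. E ^ k \<notin> ann v" "\<And>k. F ^ k \<notin> ann v"
    using extremal unfolding mem by blast
  then show ?thesis
  proof cases
    case highest
    have \<alpha>: "\<alpha> = f_val q m \<beta>" by (rule N.eigenvalue_of_E_mem[OF weight xi highest])
    have ladder_E: "\<exists>a. ladder i = a * E" if "i > 0" for i using ladder_pos[OF that] by blast
    show ?thesis
    proof (cases rule: N.F_power_dichotomy)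
      case (finite n)
      have "ladder i \<notin> ann v" if "i \<le> 0" "nat (- i) \<le> n" for i
        using that finite(2) by (cases "i = 0") (auto simp: ladder_def N.one_notin)
      moreover have "\<exists>a. ladder i = a * F ^ Suc n" if "i \<le> 0" "\<not> nat (- i) \<le> n" for i
        using that ladder_neg[of i "Suc n"] by auto
      ultimately have iso: "module_iso (Uq q m) V (quot_module (Uq q m)
          (left_span (Uq q m) (P_ideal q m \<alpha> \<beta>) <+>\<^bsub>Uq q m\<^esub> left_span (Uq q m) {cls q m E}
            <+>\<^bsub>Uq q m\<^esub> left_span (Uq q m) {cls q m (F ^ Suc n)}))"
        using ladder_E by (intro iso_two_vanishing highest finite) (meson not_le)
      have "\<alpha> + f_down \<beta> n = 0"
        using N.F_power_Suc_mem_iff[OF weight xi finite(2)] finite(1) by simp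
      then have "\<beta> ^ m = q ^ (m * n) \<or> \<beta> ^ m = - (q ^ (m * n))"
        using f_val_add_f_down_eq_0_iff[OF beta_nonzero] \<alpha> by simp
      with iso show ?thesis
        unfolding cls_power uE_def [symmetric] uF_def [symmetric] Suc_eq_plus1
        using \<alpha>[unfolded f_val_eq_power_int] beta_nonzero by blast
    next
      case infinite
      then have "ladder i \<notin> ann v" if "i \<le> 0" for i
        using that by (cases "i = 0") (auto simp: ladder_def N.one_notin)
      then have iso: "module_iso (Uq q m) V (quot_module (Uq q m)
          (left_span (Uq q m) (P_ideal q m \<alpha> \<beta>) <+>\<^bsub>Uq q m\<^esub> left_span (Uq q m) {uE q m}))"
        unfolding uE_def using ladder_E by (intro iso_one_vanishing highest) (meson not_le)
      have "\<alpha> + f_down \<beta> n \<noteq> 0" for n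
        using N.F_power_Suc_mem_iff[OF weight xi infinite] infinite[of "Suc n"] by simp
      then have "\<beta> ^ m \<noteq> q ^ (m * n) \<and> \<beta> ^ m \<noteq> - (q ^ (m * n))" for n
        using f_val_add_f_down_eq_0_iff[OF beta_nonzero] \<alpha> by simp
      with iso show ?thesis using \<alpha>[unfolded f_val_eq_power_int] beta_nonzero by blast
    qed
  next
    case lowest
    have \<alpha>: "\<alpha> = 0" by (rule N.eigenvalue_of_F_mem[OF xi lowest(1)])
    have "ladder i \<notin> ann v" if "i \<ge> 0" for i using that lowest(2) by (simp add: ladder_def)
    moreover have "\<exists>a. ladder i = a * F" if "i < 0" for i using that ladder_neg[of i 1] by auto
    ultimately have iso: "module_iso (Uq q m) V (quot_module (Uq q m)
        (left_span (Uq q m) (P_ideal q m \<alpha> \<beta>) <+>\<^bsub>Uq q m\<^esub> left_span (Uq q m) {uF q m}))"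
      unfolding uF_def by (intro iso_one_vanishing lowest) (meson not_le)
    have "f_up \<beta> (Suc n) \<noteq> 0" for n
      using N.E_power_Suc_mem_iff[OF weight xi lowest(2), of n] lowest(2)[of "Suc n"] \<alpha> by simp
    then have "f_up \<beta> (nat n) \<noteq> 0" if "n \<ge> 1" for n
      using that by (cases "nat n") auto
    then have "\<forall>n::int. n \<ge> 1 \<longrightarrow>
          1 / (q - inverse q) *
            ((1 - q powi (2 * n * int m)) / (1 - q powi (2 * int m)) * \<beta> powi int m
             - (1 - q powi (- 2 * n * int m)) / (1 - q powi (- 2 * int m)) * \<beta> powi (- int m)) \<noteq> 0"
      using f_up_eq_power_int by auto
    with iso show ?thesis using \<alpha> beta_nonzero by blast
  next
    case free
    have iso: "module_iso (Uq q m) V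
        (quot_module (Uq q m) (left_span (Uq q m) (P_ideal q m \<alpha> \<beta>)))"
      by (rule iso_no_vanishing[OF free])
    have "\<alpha> + f_down \<beta> n \<noteq> 0" for n
      using N.F_power_Suc_mem_iff[OF weight xi free(2), of n] free(2)[of "Suc n"] by simp
    then have "\<alpha> \<noteq> - f_down \<beta> (nat n)" for n by (metis add.left_inverse)
    then have down: "\<forall>n::int. n \<ge> 0 \<longrightarrow>
          \<alpha> \<noteq> - (1 / (q - inverse q) *
            (q powi (- 2 * int m) * (1 - q powi (- 2 * n * int m)) / (1 - q powi (- 2 * int m)) * \<beta> powi int m
             - q powi (2 * int m) * (1 - q powi (2 * n * int m)) / (1 - q powi (2 * int m)) * \<beta> powi (- int m)))"
      using f_down_eq_power_int by simp
    have "\<alpha> - f_up \<beta> (Suc n) \<noteq> 0" for n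
      using N.E_power_Suc_mem_iff[OF weight xi free(1), of n] free(1)[of "Suc n"] by simp
    then have "\<alpha> \<noteq> f_up \<beta> (nat n)" if "n \<ge> 1" for n
      using that by (cases "nat n") auto
    then have "\<forall>n::int. n \<ge> 1 \<longrightarrow>
          \<alpha> \<noteq> 1 / (q - inverse q) *
            ((1 - q powi (2 * n * int m)) / (1 - q powi (2 * int m)) * \<beta> powi int m
             - (1 - q powi (- 2 * n * int m)) / (1 - q powi (- 2 * int m)) * \<beta> powi (- int m))"
      using f_up_eq_power_int by auto
    with iso down show ?thesis using beta_nonzero by blast
  qed
qed

end
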